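(* Let $n\ge 2$ be an integer, let $R$ be an ordered field, let $K:=R(i)$ with $i^2=-1$, and let $F=R$ or $F=K$. Let $L$ be the set of positive definite symmetric $n\times n$ matrices over $R$ if $F=R$, respectively the set of positive definite hermitian $n\times n$ matrices over $K$ if $F=K$. Assume that $R$ is $n$-real, i.e. the characteristic polynomial of every matrix in $L$ splits over $K$ into linear factors. Put $G:=\mathrm{SL}(n,F)$, $\Omega:=\mathrm{SO}(n,R)$ if $F=R$, respectively $\Omega:=\mathrm{SU}(n,K)$ if $F=K$, and $L_G:=L\cap G$. For $A,B\in L_G$ let $A\circ B$ be the unique element of $L_G$ such that $AB=(A\circ B)\,d_{A,B}$ for some (necessarily unique) $d_{A,B}\in\Omega$. Then the loop $(L_G,\circ)$ is simple.
   Context: $K=R(i)$ has a unique nonidentity automorphism $z\mapsto\bar z$ fixing $R$ elementwise and sending $i$ to $-i$; it is applied entrywise to matrices and vectors over $K$. A matrix $A$ over $K$ is hermitian if $\bar A^{T}=A$; a hermitian matrix over $K$ (resp. symmetric matrix over $R$) is positive definite if $\bar v^{T}Av>0$ for all nonzero $v\in K^n$ (resp. $v^{T}Av>0$ for all nonzero $v\in R^n$). $\mathrm{SO}(n,R)=\{A\in \mathrm{SL}(n,R): A^{T}A=I_n\}$ and $\mathrm{SU}(n,K)=\{A\in\mathrm{SL}(n,K): \bar A^{T}A=I_n\}$. Known facts underlying the setting: when $R$ is $n$-real, $\Omega$ is a subgroup of $G$ and $L_G$ is a transversal containing the identity matrix $I_n$, so every $g\in G$ is uniquely $g=A\omega$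 with $A\in L_G$, $\omega\in\Omega$, and $\circ$ is well defined; moreover $(L_G,\circ)$ is a loop with identity $I_n$ (in fact a K-loop, that is, a loop satisfying the left Bol identity $x(y\cdot xz)=(x\cdot yx)z$ and the automorphic inverse property $(xy)^{-1}=x^{-1}y^{-1}$). A loop is a set $Q$ with a binary operation having a two-sided identity $1$ and such that for all $a,b\in Q$ each of the equations $ax=b$ and $ya=b$ has a unique solution in $Q$. A subloop is a subset that is a loop under the restricted operation. A subloop $N$ of $Q$ is normal if $(ab)N=a(bN)=(aN)b$ for all $a,b\in Q$. A loop $Q$ is simple if every normal subloop is trivial, i.e. equals $\{1\}$ or $Q$. *)

theory Defs
  imports "Jordan_Normal_Form.Schur_Decomposition"
begin

section \<open>The field \<open>R(i)\<close> over an ordered field \<open>R\<close>\<close>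

text \<open>\<open>Adj_i a b\<close> is \<open>a + b i\<close>. As for the type of complex numbers, \<open>R(i)\<close> carries the partial
  order in which \<open>x < y\<close> means that \<open>y - x\<close> is a positive element of the subfield \<open>R\<close>.\<close>

datatype 'a adj_i = Adj_i (re_part: 'a) (im_part: 'a)

lemma adj_i_eq_iff: "x = y \<longleftrightarrow> re_part x = re_part y \<and> im_part x = im_part y"
  by (cases x; cases y) simp

instantiation adj_i :: (linordered_field) field
begin

definition zero_adj_i where "zero_adj_i = Adj_i 0 0"
definition one_adj_i where "one_adj_i = Adj_i 1 0"
definition plus_adj_i where
  "x + y = Adj_i (re_part x + re_part y) (im_part x + im_part y)"
definition minus_adj_i where
  "x - y = Adj_i (re_part x - re_part y) (im_part x - im_part y)"
definition uminus_adj_i where "- x = Adj_i (- re_part x) (- im_part x)"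
definition times_adj_i where
  "x * y = Adj_i (re_part x * re_part y - im_part x * im_part y)
                 (re_part x * im_part y + im_part x * re_part y)"
definition inverse_adj_i where
  "inverse x = Adj_i (re_part x / ((re_part x)\<^sup>2 + (im_part x)\<^sup>2))
                     (- im_part x / ((re_part x)\<^sup>2 + (im_part x)\<^sup>2))"
definition divide_adj_i where "x div y = x * inverse (y :: 'a adj_i)"

instance
proof
  fix x :: "'a adj_i"
  assume "x \<noteq> 0"
  then have "(re_part x)\<^sup>2 + (im_part x)\<^sup>2 \<noteq> 0"
    by (simp add: adj_i_eq_iff zero_adj_i_def sum_power2_eq_zero_iff)
  then show "inverse x * x = 1"
    by (simp add: adj_i_eq_iff inverse_adj_i_def times_adj_i_def one_adj_i_def
        add_divide_distrib[symmetric] diff_divide_distrib[symmetric] power2_eq_square)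
qed (simp_all add: adj_i_eq_iff zero_adj_i_def one_adj_i_def plus_adj_i_def minus_adj_i_def
    uminus_adj_i_def times_adj_i_def inverse_adj_i_def divide_adj_i_def algebra_simps)

end

lemmas adj_i_defs = zero_adj_i_def one_adj_i_def plus_adj_i_def minus_adj_i_def
  uminus_adj_i_def times_adj_i_def inverse_adj_i_def divide_adj_i_def

instantiation adj_i :: (linordered_field) conjugatable_ordered_field
begin

definition conjugate_adj_i where "conjugate x = Adj_i (re_part x) (- im_part x)"
definition less_eq_adj_i where
  "x \<le> y \<longleftrightarrow> re_part x \<le> re_part y \<and> im_part x = im_part y"
definition less_adj_i where
  "x < y \<longleftrightarrow> re_part x < re_part y \<and> im_part x = im_part y"

instance
  by intro_classes
    (auto simp: adj_i_eq_iff adj_i_defs conjugate_adj_i_def less_eq_adj_i_def less_adj_i_def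
      algebra_simps)

end

definition of_base :: "'a::linordered_field \<Rightarrow> 'a adj_i" where
  "of_base a = Adj_i a 0"

definition imag_unit :: "'a::linordered_field adj_i" where
  "imag_unit = Adj_i 0 1"

lemma imag_unit_squared: "imag_unit * imag_unit = - 1"
  by (simp add: imag_unit_def adj_i_defs)

lemma adj_i_decomp: "z = of_base (re_part z) + of_base (im_part z) * imag_unit"
  by (simp add: adj_i_eq_iff of_base_def imag_unit_def adj_i_defs)


section \<open>Matrix sets\<close>

definition pd_symmetric :: "nat \<Rightarrow> 'a::linordered_field mat set" where
  "pd_symmetric n = {A \<in> carrier_mat n n. transpose_mat A = A \<and>
     (\<forall>v \<in> carrier_vec n. v \<noteq> 0\<^sub>v n \<longrightarrow> v \<bullet> (A *\<^sub>v v) > 0)}"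

definition pd_hermitian :: "nat \<Rightarrow> 'a::linordered_field adj_i mat set" where
  "pd_hermitian n = {A \<in> carrier_mat n n. mat_adjoint A = A \<and>
     (\<forall>v \<in> carrier_vec n. v \<noteq> 0\<^sub>v n \<longrightarrow> conjugate v \<bullet> (A *\<^sub>v v) > 0)}"

definition SL :: "nat \<Rightarrow> 'f::field mat set" where
  "SL n = {A \<in> carrier_mat n n. det A = 1}"

definition SO :: "nat \<Rightarrow> 'a::linordered_field mat set" where
  "SO n = {A \<in> SL n. transpose_mat A * A = 1\<^sub>m n}"

definition SU :: "nat \<Rightarrow> 'a::linordered_field adj_i mat set" where
  "SU n = {A \<in> SL n. mat_adjoint A * A = 1\<^sub>m n}"

definition splits_linear :: "'f::field poly \<Rightarrow> bool" where
  "splits_linear p \<longleftrightarrow> (\<exists>c as. p = smult c (\<Prod>a\<leftarrow>as. [:- a, 1:]))"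

text \<open>The property of being \<open>n\<close>-real refers to the set \<open>L\<close>, hence there is one version for
  \<open>F = R\<close> and one for \<open>F = R(i)\<close>. The type argument stands for the ordered field \<open>R\<close>.\<close>

definition n_real_symmetric :: "'a::linordered_field itself \<Rightarrow> nat \<Rightarrow> bool" where
  "n_real_symmetric R n \<longleftrightarrow>
     (\<forall>A \<in> (pd_symmetric n :: 'a mat set). splits_linear (char_poly (map_mat of_base A)))"

definition n_real_hermitian :: "'a::linordered_field itself \<Rightarrow> nat \<Rightarrow> bool" where
  "n_real_hermitian R n \<longleftrightarrow>
     (\<forall>A \<in> (pd_hermitian n :: 'a adj_i mat set). splits_linear (char_poly A))"

text \<open>The description below denotes an actual element of \<open>T\<close> only if the products of elements of
  \<open>T\<close> decompose uniquely over \<open>T\<close> and \<open>\<Omega>\<close>, e.g. if \<open>T\<close> is a transversal of the subgroup \<open>\<Omega>\<close>.\<close>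

definition transversal_mult ::
  "'f::field mat set \<Rightarrow> 'f mat set \<Rightarrow> 'f mat \<Rightarrow> 'f mat \<Rightarrow> 'f mat" where
  "transversal_mult T \<Omega> A B = (THE C. C \<in> T \<and> (\<exists>d \<in> \<Omega>. A * B = C * d))"


section \<open>Loops\<close>

definition is_loop :: "'q set \<Rightarrow> ('q \<Rightarrow> 'q \<Rightarrow> 'q) \<Rightarrow> 'q \<Rightarrow> bool" where
  "is_loop Q f e \<longleftrightarrow>
     (\<forall>a \<in> Q. \<forall>b \<in> Q. f a b \<in> Q) \<and>
     e \<in> Q \<and> (\<forall>a \<in> Q. f e a = a \<and> f a e = a) \<and>
     (\<forall>a \<in> Q. \<forall>b \<in> Q. (\<exists>!x. x \<in> Q \<and> f a x = b) \<and> (\<exists>!y. y \<in> Q \<and> f y a = b))"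

definition is_subloop :: "'q set \<Rightarrow> 'q set \<Rightarrow> ('q \<Rightarrow> 'q \<Rightarrow> 'q) \<Rightarrow> bool" where
  "is_subloop N Q f \<longleftrightarrow> N \<subseteq> Q \<and> (\<exists>e. is_loop N f e)"

definition is_normal_subloop :: "'q set \<Rightarrow> 'q set \<Rightarrow> ('q \<Rightarrow> 'q \<Rightarrow> 'q) \<Rightarrow> bool" where
  "is_normal_subloop N Q f \<longleftrightarrow> is_subloop N Q f \<and>
     (\<forall>a \<in> Q. \<forall>b \<in> Q.
        f (f a b) ` N = f a ` (f b ` N) \<and>
        f a ` (f b ` N) = (\<lambda>x. f x b) ` (f a ` N))"

definition is_simple_loop :: "'q set \<Rightarrow> ('q \<Rightarrow> 'q \<Rightarrow> 'q) \<Rightarrow> 'q \<Rightarrow> bool" where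
  "is_simple_loop Q f e \<longleftrightarrow> is_loop Q f e \<and>
     (\<forall>N. is_normal_subloop N Q f \<longrightarrow> N = {e} \<or> N = Q)"

end

theory Submission
  imports Defs
begin

text \<open>
  Since \<open>R\<close> is \<open>2\<close>-real, it is Pythagorean, so positive definite matrices are unitarily
  diagonalizable and every \<open>g g\<^sup>*\<close> with \<open>g \<in> G\<close> has a unique positive definite square root. Hence \<open>G\<close>
  acts on \<open>L\<^sub>G\<close> by \<open>g \<cdot> b = (g b\<^sup>2 g\<^sup>*)\<^sup>1\<^sup>/\<^sup>2\<close>, and \<open>a \<circ> b = a \<cdot> b\<close>.

  The left cosets of a normal subloop \<open>N\<close> are permuted by the left multiplications, and so by all of
  \<open>G\<close>, because \<open>L\<^sub>G\<close> generates \<open>G\<close>. The kernel \<open>M\<close> of this action on cosets is a normal subgroup of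
  \<open>G\<close>, and normality of \<open>N\<close> puts \<open>N\<close> inside \<open>M\<close>. If \<open>N\<close> contains \<open>A \<noteq> 1\<close>, diagonalizing \<open>A\<close> yields
  a non-scalar diagonal matrix in \<open>M\<close>; its commutators with transvections put all transvections
  into \<open>M\<close>. Thus \<open>M = G\<close>, there is only one coset, and \<open>N = L\<^sub>G\<close>.
\<close>

section \<open>Generation of the special linear group by transvections\<close>

lemma SL_carrier: "A \<in> SL n \<Longrightarrow> A \<in> carrier_mat n n"
  by (simp add: SL_def)

lemma one_in_SL: "1\<^sub>m n \<in> SL n"
  by (simp add: SL_def)

lemma mult_in_SL: "A \<in> SL n \<Longrightarrow> B \<in> SL n \<Longrightarrow> A * B \<in> SL n"
  by (auto simp: SL_def det_mult)

lemma addrow_mat_in_SL: "i \<noteq> j \<Longrightarrow> addrow_mat n a i j \<in> SL n"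
  by (simp add: SL_def det_addrow_mat)

lemma addrow_in_SL:
  assumes "A \<in> SL n" "i \<noteq> j" "j < n"
  shows "addrow a i j A \<in> SL n"
  using assms mult_in_SL[OF addrow_mat_in_SL assms(1)] by (auto simp: SL_def addrow_mat)

lemma SL_inverse:
  assumes "A \<in> SL n"
  obtains B where "B \<in> SL n" "A * B = 1\<^sub>m n" "B * A = 1\<^sub>m n"
proof -
  have A: "A \<in> carrier_mat n n" and d: "det A = 1" using assms by (auto simp: SL_def)
  have B: "adj_mat A \<in> carrier_mat n n" "A * adj_mat A = 1\<^sub>m n" "adj_mat A * A = 1\<^sub>m n"
    using adj_mat[OF A] d by auto
  have "det (A * adj_mat A) = 1" using B(2) by simp
  hence "det (adj_mat A) = 1" using det_mult[OF A B(1)] d by simp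
  thus thesis using that B by (auto simp: SL_def)
qed

section \<open>Elimination of columns by row additions\<close>

definition unit_columns :: "nat \<Rightarrow> nat \<Rightarrow> 'f::field mat \<Rightarrow> bool" where
  "unit_columns n k A \<longleftrightarrow> (\<forall>i<n. \<forall>j<k. A $$ (i,j) = (if i = j then 1 else 0))"

text \<open>Each nonzero off-diagonal entry of column \<open>k\<close> is removed by adding a
  multiple of row \<open>k\<close>, which lowers the number of such entries. Earlier columns stay
  intact because row \<open>k\<close> vanishes there. \<open>P\<close> is pulled back along row
  additions, as the induction rule below requires.\<close>

lemma clear_column:
  assumes step: "\<And>A a i j. A \<in> SL n \<Longrightarrow> i < n \<Longrightarrow> j < n \<Longrightarrow> i \<noteq> j \<Longrightarrow> P (addrow a i j A) \<Longrightarrow> P A"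
    and goal: "\<And>B. B \<in> SL n \<Longrightarrow> unit_columns n (Suc k) B \<Longrightarrow> P B"
    and k: "k < n"
  shows "A \<in> SL n \<Longrightarrow> unit_columns n k A \<Longrightarrow> A $$ (k,k) = 1 \<Longrightarrow> P A"
proof (induction "card {i. i < n \<and> i \<noteq> k \<and> A $$ (i,k) \<noteq> 0}" arbitrary: A rule: less_induct)
  case less
  let ?S = "\<lambda>A. {i. i < n \<and> i \<noteq> k \<and> A $$ (i,k) \<noteq> (0::'a)}"
  have A: "A \<in> carrier_mat n n" using less.prems SL_carrier by auto
  show ?case
  proof (cases "?S A = {}")
    case True
    have "unit_columns n (Suc k) A"
      using True less.prems(2,3) by (auto simp: unit_columns_def less_Suc_eq)
    thus ?thesis using goal[OF less.prems(1)] by simp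
  next
    case False
    then obtain i where i: "i < n" "i \<noteq> k" "A $$ (i,k) \<noteq> 0" by auto
    let ?B = "addrow (- (A $$ (i,k))) i k A"
    have row: "?B $$ (j,k) = (if j = i then 0 else A $$ (j,k))" if "j < n" for j
      using A i(1) k less.prems(3) that by simp
    have "?S ?B = ?S A - {i}" using row by (auto split: if_splits)
    hence "?S ?B \<subset> ?S A" using i by blast
    hence "card (?S ?B) < card (?S A)" by (intro psubset_card_mono) auto
    moreover have "?B \<in> SL n" using addrow_in_SL less.prems(1) i k by blast
    moreover have "unit_columns n k ?B"
      using less.prems(2) A i k by (auto simp: unit_columns_def)
    moreover have "?B $$ (k,k) = 1" using less.prems A i k by auto
    ultimately have "P ?B" using less.hyps[of ?B] by simp
    thus ?thesis by (rule step[OF less.prems(1) i(1) k i(2)])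
  qed
qed

text \<open>Otherwise column \<open>k\<close> would be a combination of the first \<open>k\<close>
  columns, which are unit vectors. The coefficients of this dependency form a kernel vector
  \<open>v\<close>, contradicting the nonzero determinant.\<close>

lemma SL_column_nonzero:
  assumes "A \<in> SL n" and U: "unit_columns n k A" and k: "k < n"
  shows "\<exists>i\<ge>k. i < n \<and> A $$ (i,k) \<noteq> 0"
proof (rule ccontr)
  assume "\<not> ?thesis"
  hence z: "A $$ (i,k) = 0" if "k \<le> i" "i < n" for i using that by blast
  have A: "A \<in> carrier_mat n n" "det A = 1" using assms(1) by (auto simp: SL_def)
  define v where "v = vec n (\<lambda>j. if j < k then - (A $$ (j,k)) else if j = k then 1 else 0)"
  have v: "v \<in> carrier_vec n" by (simp add: v_def)
  have "v $ k \<noteq> 0\<^sub>v n $ k" using k by (simp add: v_def)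
  hence v0: "v \<noteq> 0\<^sub>v n" by auto
  have "A *\<^sub>v v = 0\<^sub>v n"
  proof (rule eq_vecI)
    fix i assume "i < dim_vec (0\<^sub>v n :: 'a vec)"
    hence i: "i < n" by simp
    have "(A *\<^sub>v v) $ i = (\<Sum>j<n. A $$ (i,j) * v $ j)"
      using A v i by (simp add: scalar_prod_def lessThan_atLeast0)
    also have "\<dots> = (\<Sum>j<n. (if j = i \<and> i < k then - (A $$ (i,k)) else 0) + (if j = k then A $$ (i,k) else 0))"
      by (rule sum.cong) (use U i k in \<open>auto simp: v_def unit_columns_def\<close>)
    also have "\<dots> = 0" using i k z[of i] by (cases "i < k") (auto simp: sum.distrib)
    finally show "(A *\<^sub>v v) $ i = 0\<^sub>v n $ i" using i by simp
  qed (use A in simp)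
  hence "det A = 0" using det_0_iff_vec_prod_zero_field[OF A(1)] v v0 by blast
  thus False using A by simp
qed

text \<open>Gaussian elimination: as the determinant is one, a pivot can be made one by a row addition
  instead of a scaling, except in the last column, where it is one already.\<close>

lemma SL_elementary_induct [consumes 1, case_names one addrow]:
  fixes A :: "'f::field mat"
  assumes "A \<in> SL n"
    and one: "P (1\<^sub>m n)"
    and step: "\<And>A a i j. A \<in> SL n \<Longrightarrow> i < n \<Longrightarrow> j < n \<Longrightarrow> i \<noteq> j \<Longrightarrow> P (addrow a i j A) \<Longrightarrow> P A"
  shows "P A"
proof -
  have "k \<le> n \<Longrightarrow> A \<in> SL n \<Longrightarrow> unit_columns n k A \<Longrightarrow> P A" for k and A :: "'f mat"
  proof (induction "n - k" arbitrary: k A rule: less_induct)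
    case less
    note SLA = less.prems(2) and U = less.prems(3)
    have A: "A \<in> carrier_mat n n" "det A = 1" using SLA by (auto simp: SL_def)
    show ?case
    proof (cases "k = n")
      case True
      have "A = 1\<^sub>m n" by (rule eq_matI) (use U A True in \<open>auto simp: unit_columns_def\<close>)
      thus ?thesis using one by simp
    next
      case False
      hence k: "k < n" using less.prems by simp
      have goal: "P B" if "B \<in> SL n" "unit_columns n (Suc k) B" for B
        using less.hyps[of "Suc k" B] that k by auto
      have clear: "P B" if "B \<in> SL n" "unit_columns n k B" "B $$ (k,k) = 1" for B
        by (rule clear_column[of n P k, OF _ _ k that]) (fact step goal)+
      show ?thesis
      proof (cases "Suc k = n")
        case True
        \<comment> \<open>All columns but the last are unit columns, so the determinant is the last
          diagonal entry.\<close>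
        have "upper_triangular A"
          using U A True by (auto simp: unit_columns_def)
        hence "(\<Prod>i<n. A $$ (i,i)) = 1"
          using det_upper_triangular[of A n] A by (simp add: prod_list_diag_prod lessThan_atLeast0)
        moreover have "(\<Prod>i<n. A $$ (i,i)) = (\<Prod>i<k. A $$ (i,i)) * A $$ (k,k)"
          by (simp add: True[symmetric])
        moreover have "(\<Prod>i<k. A $$ (i,i)) = 1"
          by (rule prod.neutral) (use U k in \<open>auto simp: unit_columns_def\<close>)
        ultimately have "A $$ (k,k) = 1" by simp
        thus ?thesis by (rule clear[OF SLA U])
      next
        case False
        hence k1: "Suc k < n" using k by simp
        \<comment> \<open>The multiple of row \<open>j\<close> is chosen so that the new diagonal
          entry is exactly one; \<open>j > k\<close> guarantees that earlier columns do not
          change.\<close>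
        have pivot: "P B" if B: "B \<in> SL n" "unit_columns n k B" and j: "k < j" "j < n" "B $$ (j,k) \<noteq> 0"
          for B j
        proof -
          let ?C = "addrow ((1 - B $$ (k,k)) / B $$ (j,k)) k j B"
          have B': "B \<in> carrier_mat n n" using B SL_carrier by auto
          have "?C \<in> SL n" using addrow_in_SL[OF B(1) _ j(2), of k] j by auto
          moreover have "unit_columns n k ?C" using B(2) B' j k by (auto simp: unit_columns_def)
          moreover have "?C $$ (k,k) = 1" using B' j k by simp
          ultimately have "P ?C" by (rule clear)
          thus ?thesis using step[OF B(1) k j(2)] j(1) by simp
        qed
        obtain i where i: "k \<le> i" "i < n" "A $$ (i,k) \<noteq> 0"
          using SL_column_nonzero[OF SLA U k] by blast
        show ?thesis
        proof (cases "A $$ (Suc k, k) = 0")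
          case False
          thus ?thesis using pivot[of A "Suc k"] SLA U k1 by auto
        next
          case 0: True
          show ?thesis
          proof (cases "i = k")
            case False
            thus ?thesis using pivot[of A i] SLA U i by auto
          next
            case True
            \<comment> \<open>The diagonal entry is nonzero and the entry below it is zero; adding
              row \<open>k\<close> to the next row produces a nonzero entry below the diagonal to
              pivot with.\<close>
            let ?C = "addrow 1 (Suc k) k A"
            have "?C \<in> SL n" using addrow_in_SL[OF SLA _ k, of "Suc k"] by auto
            moreover have "unit_columns n k ?C" using U A k k1 by (auto simp: unit_columns_def)
            moreover have "?C $$ (Suc k,k) \<noteq> 0" using A k k1 True i 0 by auto
            ultimately have "P ?C" using pivot[of ?C "Suc k"] k1 by auto
            thus ?thesis using step[OF SLA k1 k] by auto
          qed
        qed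
      qed
    qed
  qed
  from this[of 0 A] show ?thesis using assms(1) by (auto simp: unit_columns_def)
qed

text \<open>A row addition is undone by the opposite transvection, which again lies in
  \<open>S\<close>; so membership in \<open>S\<close> can be pulled back along the
  elimination.\<close>

lemma SL_generated:
  fixes S :: "'f::field mat set"
  assumes one: "1\<^sub>m n \<in> S"
    and mult: "\<And>A B. A \<in> S \<Longrightarrow> B \<in> S \<Longrightarrow> A * B \<in> S"
    and elementary: "\<And>a i j. i < n \<Longrightarrow> j < n \<Longrightarrow> i \<noteq> j \<Longrightarrow> addrow_mat n a i j \<in> S"
    and A: "A \<in> SL n"
  shows "A \<in> S"
  using A
proof (induction rule: SL_elementary_induct)
  case one
  show ?case by (rule assms(1))
next
  case (addrow A a i j)
  have A: "A \<in> carrier_mat n n" using addrow by (simp add: SL_carrier)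
  have "addrow_mat n (- a) i j * addrow a i j A = addrow (- a) i j (addrow a i j A)"
    using A addrow by (intro addrow_mat[symmetric]) auto
  also have "\<dots> = A"
    by (rule eq_matI) (use A addrow in auto)
  finally show ?case using mult elementary addrow by metis
qed

section \<open>Hermitian forms and positive definite matrices\<close>

lemma dim_mat_diag [simp]: "dim_row (mat_diag n f) = n" "dim_col (mat_diag n f) = n"
  by (simp_all add: mat_diag_def)

lemma det_mat_diag: "det (mat_diag n f) = (\<Prod>i<n. f i)"
  by (subst det_upper_triangular[of _ n])
    (auto simp: mat_diag_def prod_list_diag_prod lessThan_atLeast0)

text \<open>Covers both cases: \<open>cj\<close> is the identity for \<open>F = R\<close> and the conjugation for \<open>F = R(i)\<close>;
  \<open>emb\<close> embeds \<open>R\<close> into \<open>F\<close>.\<close>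

locale conj_field = emb: field_hom emb + cj: field_hom cj
  for emb :: "'a::linordered_field \<Rightarrow> 'f::field" and cj :: "'f \<Rightarrow> 'f" +
  assumes cj_cj [simp]: "cj (cj x) = x"
    and cj_emb [simp]: "cj (emb r) = emb r"
    and cj_fixed: "cj x = x \<Longrightarrow> \<exists>r. x = emb r"
    and norm_pos: "x \<noteq> 0 \<Longrightarrow> \<exists>r>0. x * cj x = emb r"
begin

text \<open>\<open>nrm x\<close> is the squared absolute value of \<open>x\<close>.\<close>

definition nrm :: "'f \<Rightarrow> 'a" where
  "nrm x = (THE r. emb r = x * cj x)"

lemma emb_nrm: "emb (nrm x) = x * cj x"
proof -
  obtain r where r: "emb r = x * cj x"
    using norm_pos[of x] emb.hom_zero by (cases "x = 0") (metis mult_zero_left)+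
  show ?thesis unfolding nrm_def by (rule theI[of _ r]) (use r in \<open>auto simp: emb.eq_iff[symmetric]\<close>)
qed

lemma nrm_zero [simp]: "nrm 0 = 0"
  using emb_nrm[of 0] by (simp del: emb.hom_zero add: emb.hom_0_iff)

lemma nrm_pos: "x \<noteq> 0 \<Longrightarrow> nrm x > 0"
  using norm_pos[of x] emb_nrm[of x] by (metis emb.eq_iff)

lemma nrm_nonneg [simp]: "nrm x \<ge> 0"
  using nrm_pos[of x] by (cases "x = 0") auto

lemma nrm_mult: "nrm (x * y) = nrm x * nrm y"
proof -
  have "emb (nrm (x * y)) = emb (nrm x * nrm y)"
    by (simp only: emb_nrm emb.hom_mult cj.hom_mult) (simp add: ac_simps)
  thus ?thesis by (simp only: emb.eq_iff)
qed

lemma nrm_emb: "nrm (emb c) = c * c"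
proof -
  have "emb (nrm (emb c)) = emb (c * c)" by (simp add: emb_nrm emb.hom_mult)
  thus ?thesis by (simp only: emb.eq_iff)
qed

section \<open>Adjoints and positive definiteness\<close>

definition adj :: "'f mat \<Rightarrow> 'f mat" where
  "adj A = map_mat cj (transpose_mat A)"

lemma adj_carrier [simp]: "adj A \<in> carrier_mat m n \<longleftrightarrow> A \<in> carrier_mat n m"
  by (simp add: adj_def)

lemma dim_adj [simp]: "dim_row (adj A) = dim_col A" "dim_col (adj A) = dim_row A"
  by (simp_all add: adj_def)

lemma index_adj [simp]: "i < dim_col A \<Longrightarrow> j < dim_row A \<Longrightarrow> adj A $$ (i,j) = cj (A $$ (j,i))"
  by (simp add: adj_def)

lemma adj_adj [simp]: "adj (adj A) = A"
  by (rule eq_matI) auto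

lemma adj_one [simp]: "adj (1\<^sub>m n) = 1\<^sub>m n"
  by (rule eq_matI) auto

lemma adj_mult:
  assumes "A \<in> carrier_mat n m" "B \<in> carrier_mat m k"
  shows "adj (A * B) = adj B * adj A"
  using assms by (simp add: adj_def transpose_mult[OF assms] cj.mat_hom_mult[of _ k m _ n])

lemma det_adj: "A \<in> carrier_mat n n \<Longrightarrow> det (adj A) = cj (det A)"
  by (simp add: adj_def cj.hom_det det_transpose)

lemma adj_mat_diag: "adj (mat_diag n (\<lambda>i. emb (d i))) = mat_diag n (\<lambda>i. emb (d i))"
  by (rule eq_matI) (auto simp: mat_diag_def)

lemma adj_in_SL: "A \<in> SL n \<Longrightarrow> adj A \<in> SL n"
  by (auto simp: SL_def det_adj)

lemma cscalar_adj:
  assumes "A \<in> carrier_mat n m" "v \<in> carrier_vec n" "w \<in> carrier_vec m"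
  shows "map_vec cj v \<bullet> (A *\<^sub>v w) = map_vec cj (adj A *\<^sub>v v) \<bullet> w"
proof -
  have "map_vec cj (adj A *\<^sub>v v) = transpose_mat A *\<^sub>v map_vec cj v"
    using assms by (intro eq_vecI) (auto simp: scalar_prod_def cj.hom_sum cj.hom_mult)
  thus ?thesis
    using assms transpose_vec_mult_scalar[OF assms(1,3), of "map_vec cj v"] by simp
qed

lemma cscalar_self:
  "v \<in> carrier_vec n \<Longrightarrow> map_vec cj v \<bullet> v = emb (\<Sum>i<n. nrm (v $ i))"
  by (simp add: scalar_prod_def emb.hom_sum emb_nrm lessThan_atLeast0 mult.commute)

lemma sum_nrm_pos:
  assumes "v \<in> carrier_vec n" "v \<noteq> 0\<^sub>v n" "\<And>i. i < n \<Longrightarrow> d i > 0"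
  shows "(\<Sum>i<n. d i * nrm (v $ i)) > 0"
proof -
  obtain i where "i < n" "v $ i \<noteq> 0" using assms(1,2) by (metis eq_vecI index_zero_vec carrier_vecD)
  thus ?thesis using assms(3)
    by (intro sum_pos2[of _ i]) (auto simp: less_imp_le nrm_pos)
qed

text \<open>The field \<open>F\<close> carries no order in this locale. Positivity of the form is
  therefore expressed by a positive preimage of its value in \<open>R\<close>.\<close>

definition pd :: "nat \<Rightarrow> 'f mat set" where
  "pd n = {A \<in> carrier_mat n n. adj A = A \<and>
     (\<forall>v \<in> carrier_vec n. v \<noteq> 0\<^sub>v n \<longrightarrow> (\<exists>r>0. map_vec cj v \<bullet> (A *\<^sub>v v) = emb r))}"

lemma pd_diag:
  assumes "\<And>i. i < n \<Longrightarrow> d i > 0"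
  shows "mat_diag n (\<lambda>i. emb (d i)) \<in> pd n"
proof -
  have "\<exists>r>0. map_vec cj v \<bullet> (mat_diag n (\<lambda>i. emb (d i)) *\<^sub>v v) = emb r"
    if v: "v \<in> carrier_vec n" "v \<noteq> 0\<^sub>v n" for v
  proof (intro exI conjI)
    have "mat_diag n (\<lambda>i. emb (d i)) *\<^sub>v v = vec n (\<lambda>i. emb (d i) * v $ i)"
      using v by (intro eq_vecI)
        (auto simp: mat_diag_def scalar_prod_def if_distrib[of "\<lambda>x. x * _"] cong: if_cong)
    thus "map_vec cj v \<bullet> (mat_diag n (\<lambda>i. emb (d i)) *\<^sub>v v) = emb (\<Sum>i<n. d i * nrm (v $ i))"
      using v by (auto simp: scalar_prod_def emb.hom_sum emb_nrm emb.hom_mult lessThan_atLeast0 ac_simps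
          intro!: sum.cong)
  qed (use sum_nrm_pos v assms in blast)
  thus ?thesis by (simp add: pd_def adj_mat_diag)
qed

lemma one_in_pd: "1\<^sub>m n \<in> pd n"
  using pd_diag[of n "\<lambda>_. 1"] by simp

lemma pd_congruence:
  assumes A: "A \<in> pd n" and g: "g \<in> carrier_mat n n" "det g \<noteq> 0"
  shows "g * A * adj g \<in> pd n"
proof -
  have A': "A \<in> carrier_mat n n" "adj A = A" using A by (auto simp: pd_def)
  have "adj (g * A * adj g) = g * A * adj g"
    using A' g by (simp add: adj_mult[of _ n n _ n])
  moreover have "\<exists>r>0. map_vec cj v \<bullet> (g * A * adj g *\<^sub>v v) = emb r"
    if v: "v \<in> carrier_vec n" "v \<noteq> 0\<^sub>v n" for v
  proof -
    have "det (adj g) \<noteq> 0" using g by (simp add: det_adj)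
    hence "adj g *\<^sub>v v \<noteq> 0\<^sub>v n" using det_0_iff_vec_prod_zero_field[of "adj g" n] g v by auto
    moreover have c: "adj g *\<^sub>v v \<in> carrier_vec n" using g v by simp
    ultimately obtain r where "r > 0" "map_vec cj (adj g *\<^sub>v v) \<bullet> (A *\<^sub>v (adj g *\<^sub>v v)) = emb r"
      using A unfolding pd_def by blast
    moreover have "map_vec cj v \<bullet> (g * A * adj g *\<^sub>v v)
        = map_vec cj (adj g *\<^sub>v v) \<bullet> (A *\<^sub>v (adj g *\<^sub>v v))"
      using cscalar_adj[OF g(1) v(1), of "A *\<^sub>v (adj g *\<^sub>v v)"] A' g v
      by (simp add: assoc_mult_mat_vec[of _ n n _ n])
    ultimately show ?thesis by auto
  qed
  ultimately show ?thesis using A' g by (auto simp: pd_def)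
qed

lemma pd_gram: "g \<in> SL n \<Longrightarrow> g * adj g \<in> pd n"
  using pd_congruence[OF one_in_pd, of g n] by (auto simp: SL_def)

text \<open>The root \<open>c\<close> of a partial sum re-enters as an element of \<open>F\<close>:
  its square is \<open>nrm (emb c)\<close>, so the assumption on two summands applies again.\<close>

lemma sum_nrm_square:
  assumes pyth: "\<And>x y. \<exists>c. c * c = nrm x + nrm y" and "finite I"
  shows "\<exists>c\<ge>0. c * c = (\<Sum>i\<in>I. nrm (f i))"
  using \<open>finite I\<close>
proof (induction I rule: finite_induct)
  case empty
  show ?case by (rule exI[of _ 0]) simp
next
  case (insert i I)
  then obtain c where c: "c * c = (\<Sum>i\<in>I. nrm (f i))" by auto
  obtain b where "b * b = nrm (f i) + nrm (emb c)" using pyth by blast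
  thus ?case using insert c by (intro exI[of _ "\<bar>b\<bar>"]) (simp add: nrm_emb)
qed

text \<open>The reflection that swaps \<open>v\<close> and the first unit vector \<open>e\<close>. The sign condition on the first entry
  of \<open>v\<close> makes \<open>v - e\<close> nonzero.\<close>

lemma householder:
  assumes v: "v \<in> carrier_vec (Suc m)" "(\<Sum>i<Suc m. nrm (v $ i)) = 1"
    and v0: "v $ 0 = emb r" "r \<le> 0"
  obtains H where "H \<in> carrier_mat (Suc m) (Suc m)" "adj H = H" "H * H = 1\<^sub>m (Suc m)" "col H 0 = v"
proof -
  define w where "w i = v $ i - (if i = 0 then 1 else 0)" for i
  \<comment> \<open>For the difference vector \<open>w\<close> of \<open>v\<close> and the first
    unit vector, the squared norm is \<open>2 * (1 - r)\<close> because \<open>v\<close> has norm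
    one. So \<gamma> is the usual reflection factor, two divided by that squared norm.\<close>
  define \<gamma> where "\<gamma> = inverse (emb (1 - r))"
  have \<gamma>: "cj \<gamma> = \<gamma>" by (simp add: \<gamma>_def cj.hom_inverse)
  have "1 - r \<noteq> 0" using v0 by simp
  hence "emb (1 - r) \<noteq> 0" by (simp only: emb.hom_0_iff not_False_eq_True)
  hence \<gamma>1: "\<gamma> * (1 - emb r) = 1"
    unfolding \<gamma>_def by (simp add: emb.hom_minus)
  define H where "H = mat (Suc m) (Suc m) (\<lambda>(i,j). (if i = j then 1 else 0) - \<gamma> * w i * cj (w j))"
  have H: "H \<in> carrier_mat (Suc m) (Suc m)" by (simp add: H_def)
  have "adj H = H"
    by (rule eq_matI) (auto simp: H_def cj.hom_minus cj.hom_mult \<gamma> ac_simps)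
  moreover have "col H 0 = v"
  proof (rule eq_vecI)
    fix i assume "i < dim_vec v"
    hence i: "i < Suc m" using v by simp
    have "col H 0 $ i = (if i = 0 then 1 else 0) - \<gamma> * w i * cj (w 0)"
      using i by (simp add: H_def)
    also have "cj (w 0) = - (1 - emb r)" by (simp add: w_def v0 cj.hom_minus)
    also have "\<gamma> * w i * - (1 - emb r) = - (\<gamma> * (1 - emb r)) * w i" by (simp add: algebra_simps)
    also have "(if i = 0 then 1 else 0) - \<dots> = (if i = 0 then 1 else 0) + w i" unfolding \<gamma>1 by simp
    finally show "col H 0 $ i = v $ i" by (simp add: w_def)
  qed (use v H in simp)
  moreover have "H * H = 1\<^sub>m (Suc m)"
  proof (rule eq_matI)
    fix i j assume "i < dim_row (1\<^sub>m (Suc m) :: 'f mat)" "j < dim_col (1\<^sub>m (Suc m) :: 'f mat)"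
    hence ij: "i < Suc m" "j < Suc m" by auto
    have "(\<Sum>k<Suc m. w k * cj (w k)) = (\<Sum>k<Suc m. v $ k * cj (v $ k)) - 2 * emb r + 1"
      unfolding sum.lessThan_Suc_shift by (simp add: w_def v0 cj.hom_minus algebra_simps)
    also have "(\<Sum>k<Suc m. v $ k * cj (v $ k)) = emb 1"
      unfolding v(2)[symmetric] by (simp only: emb.hom_sum emb_nrm)
    finally have ww: "(\<Sum>k<Suc m. w k * cj (w k)) = 2 * (1 - emb r)" by simp
    have "(H * H) $$ (i,j) = (\<Sum>k<Suc m. H $$ (i,k) * H $$ (k,j))"
      using ij H by (simp add: scalar_prod_def lessThan_atLeast0 del: sum.lessThan_Suc sum.op_ivl_Suc)
    also have "\<dots> = (\<Sum>k<Suc m. (if k = i then (if i = j then 1 else 0) - \<gamma> * w i * cj (w j) else 0)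
        - (if k = j then \<gamma> * w i * cj (w j) else 0) + \<gamma> * \<gamma> * w i * cj (w j) * (w k * cj (w k)))"
      by (rule sum.cong) (use ij in \<open>auto simp: H_def algebra_simps\<close>)
    also have "\<dots> = (if i = j then 1 else 0) - \<gamma> * w i * cj (w j) - \<gamma> * w i * cj (w j)
        + \<gamma> * \<gamma> * w i * cj (w j) * (2 * (1 - emb r))"
      unfolding ww[symmetric] using ij
      by (simp add: sum.distrib sum_subtractf sum_distrib_left del: sum.lessThan_Suc)
    also have "\<gamma> * \<gamma> * w i * cj (w j) * (2 * (1 - emb r)) = (\<gamma> * (1 - emb r)) * (2 * (\<gamma> * w i * cj (w j)))"
      by (simp only: ac_simps)
    also have "(if i = j then 1 else 0) - \<gamma> * w i * cj (w j) - \<gamma> * w i * cj (w j) + \<dots>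
        = (if i = j then 1 else 0)"
      unfolding \<gamma>1 by simp
    finally show "(H * H) $$ (i,j) = 1\<^sub>m (Suc m) $$ (i,j)" using ij by simp
  qed (use H in auto)
  ultimately show thesis using that H by blast
qed

end

section \<open>The spectral theorem over Pythagorean fields\<close>

lemma splits_monic:
  assumes "splits_linear p" "lead_coeff p = 1"
  obtains as where "p = (\<Prod>a\<leftarrow>as. [:- a, 1:])"
proof -
  obtain c as where p: "p = smult c (\<Prod>a\<leftarrow>as. [:- a, 1:])"
    using assms(1) by (auto simp: splits_linear_def)
  have "lead_coeff (\<Prod>a\<leftarrow>as. [:- a, 1:]) = 1" for as :: "'a list"
    by (induction as) (simp_all add: lead_coeff_mult del: mult_pCons_left)
  hence "c = 1" using assms(2) unfolding p by (simp only: lead_coeff_smult mult_1_right)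
  thus thesis using that p by simp
qed

lemma char_poly_splits:
  assumes "A \<in> carrier_mat n n" "splits_linear (char_poly A)"
  obtains as where "char_poly A = (\<Prod>a\<leftarrow>as. [:- a, 1:])"
  using splits_monic[OF assms(2)] degree_monic_char_poly[OF assms(1)] by metis

text \<open>Deflation: \<open>a\<close> is a root of the product, hence occurs in \<open>bs\<close>,
  and its factor can be cancelled. This keeps the smaller block split in the inductions on the
  dimension.\<close>

lemma prod_linear_cancel:
  fixes q :: "'a::field poly"
  assumes "[:- a, 1:] * q = (\<Prod>b\<leftarrow>bs. [:- b, 1:])"
  shows "q = (\<Prod>b\<leftarrow>remove1 a bs. [:- b, 1:])"
proof -
  have "poly (\<Prod>b\<leftarrow>bs. [:- b, 1:]) a = 0" unfolding assms[symmetric] by simp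
  hence "a \<in> set bs" by (induction bs) auto
  hence "(\<Prod>b\<leftarrow>bs. [:- b, 1:]) = [:- a, 1:] * (\<Prod>b\<leftarrow>remove1 a bs. [:- b, 1:])"
    by (induction bs) (auto simp: mult.left_commute simp del: mult_pCons_left)
  thus ?thesis using assms mult_left_cancel[of "[:- a, 1:]"] by simp
qed

lemma char_poly_diag_block:
  assumes "B \<in> carrier_mat m m"
  shows "char_poly (four_block_mat (mat 1 1 (\<lambda>_. a)) (0\<^sub>m 1 m) (0\<^sub>m m 1) B)
    = [:- a, 1:] * char_poly B"
proof -
  have "char_poly (mat 1 1 (\<lambda>_. a)) = [:- a, 1:]"
    by (subst char_poly_upper_triangular[of _ 1]) (auto simp: diag_mat_def)
  thus ?thesis using char_poly_four_block_zeros_col[of "mat 1 1 (\<lambda>_. a)" "0\<^sub>m 1 m" m B] assms by simp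
qed

context conj_field
begin

text \<open>Induction on the dimension. A root of the characteristic polynomial gives a unit
  eigenvector, and a reflection \<open>H\<close> has it as first column. Then \<open>H A H\<close>
  is block diagonal with a smaller self-adjoint block, whose characteristic polynomial still
  splits.\<close>

lemma spectral:
  assumes pyth: "\<And>x y. \<exists>c. c * c = nrm x + nrm y"
  shows "A \<in> carrier_mat m m \<Longrightarrow> adj A = A \<Longrightarrow> char_poly A = (\<Prod>a\<leftarrow>as. [:- a, 1:]) \<Longrightarrow>
    \<exists>P d. P \<in> carrier_mat m m \<and> adj P * P = 1\<^sub>m m \<and> A * P = P * mat_diag m (\<lambda>i. emb (d i))"
proof (induction m arbitrary: A as)
  case 0
  show ?case by (rule exI[of _ "1\<^sub>m 0"], rule exI[of _ "\<lambda>_. 0"]) (use 0 in \<open>auto simp: mat_eq_iff\<close>)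
next
  case (Suc m)
  let ?n = "Suc m"
  note A = Suc.prems(1,2)
  have "as \<noteq> []" using degree_monic_char_poly[OF A(1)] Suc.prems(3) by auto
  then obtain a bs where as: "as = a # bs" by (cases as) auto
  hence "eigenvalue A a" using eigenvalue_root_char_poly[OF A(1)] Suc.prems(3) by simp
  then obtain u where u: "u \<in> carrier_vec ?n" "u \<noteq> 0\<^sub>v ?n" "A *\<^sub>v u = a \<cdot>\<^sub>v u"
    using A by (auto simp: eigenvalue_def eigenvector_def)
  \<comment> \<open>The scalar turns the first entry of \<open>u\<close> into minus its norm, as
    \<open>householder\<close> needs a first entry in \<open>R\<close> that is at most zero. If this
    entry vanishes, any nonzero scalar does.\<close>
  define \<kappa> where "\<kappa> = (if u $ 0 = 0 then 1 else - cj (u $ 0))"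
  have \<kappa>: "\<kappa> \<noteq> 0" by (simp add: \<kappa>_def)
  have \<kappa>u: "\<kappa> * u $ 0 = emb (- nrm (u $ 0))"
    by (simp add: \<kappa>_def emb.hom_uminus emb_nrm)
  obtain s where s: "s \<ge> 0" "s * s = (\<Sum>i<?n. nrm (\<kappa> * u $ i))"
    using sum_nrm_square[OF pyth, of "{..<?n}" "\<lambda>i. \<kappa> * u $ i"] by blast
  have "\<kappa> \<cdot>\<^sub>v u \<noteq> 0\<^sub>v ?n"
    using u \<kappa> by (metis index_smult_vec(1) index_zero_vec mult_eq_0_iff eq_vecI carrier_vecD)
  from sum_nrm_pos[OF _ this, of "\<lambda>_. 1"] have "s \<noteq> 0" using s u by auto
  define v where "v = (emb (inverse s) * \<kappa>) \<cdot>\<^sub>v u"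
  have v: "v \<in> carrier_vec ?n" using u by (simp add: v_def)
  have "(\<Sum>i<?n. nrm (v $ i)) = (\<Sum>i<?n. inverse s * inverse s * nrm (\<kappa> * u $ i))"
    using u by (intro sum.cong) (auto simp: v_def nrm_mult nrm_emb)
  also have "\<dots> = inverse s * inverse s * (s * s)" by (simp only: sum_distrib_left s(2))
  also have "\<dots> = 1" using \<open>s \<noteq> 0\<close> by (simp add: field_simps)
  finally have v1: "(\<Sum>i<?n. nrm (v $ i)) = 1" .
  have "v $ 0 = emb (inverse s) * (\<kappa> * u $ 0)" using u by (simp add: v_def ac_simps)
  hence v0: "v $ 0 = emb (inverse s * - nrm (u $ 0))" by (simp only: \<kappa>u emb.hom_mult)
  have "inverse s * - nrm (u $ 0) \<le> 0" using s(1) by simp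
  then obtain H where H: "H \<in> carrier_mat ?n ?n" "adj H = H" "H * H = 1\<^sub>m ?n" "col H 0 = v"
    using householder[OF v v1 v0] by blast
  have Av: "A *\<^sub>v v = a \<cdot>\<^sub>v v"
    using u A by (simp add: v_def mult_mat_vec[of _ ?n ?n] smult_smult_assoc mult.commute)
  define A' where "A' = H * (A * H)"
  have A': "A' \<in> carrier_mat ?n ?n" "adj A' = A'"
    using A H by (simp_all add: A'_def adj_mult[of _ ?n ?n _ ?n])
  have "col A' 0 = H *\<^sub>v col (A * H) 0"
    unfolding A'_def by (rule col_mult2) (use A H in auto)
  also have "col (A * H) 0 = A *\<^sub>v col H 0"
    by (rule col_mult2) (use A H in auto)
  also have "H *\<^sub>v \<dots> = a \<cdot>\<^sub>v (H *\<^sub>v col H 0)"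
    using H v by (simp add: Av mult_mat_vec[of _ ?n ?n])
  also have "H *\<^sub>v col H 0 = unit_vec ?n 0"
    using H(1) col_mult2[of H ?n ?n H ?n 0] unfolding H(3) by simp
  finally have col0: "A' $$ (i,0) = (if i = 0 then a else 0)" if "i < ?n" for i
    using that A' by (metis (no_types, lifting) index_col carrier_matD index_smult_vec(1) index_unit_vec(1,3)
      mult_cancel_left2 mult_zero_right zero_less_Suc)
  have row0: "A' $$ (0,i) = cj (A' $$ (i,0))" if "i < ?n" for i
    using A' that by (metis index_adj carrier_matD zero_less_Suc)
  \<comment> \<open>The corner entry of a self-adjoint matrix is its own conjugate, so the
    eigenvalue comes from \<open>R\<close>. Likewise the first row is the conjugate of the first
    column and vanishes off the corner.\<close>
  have ca: "cj a = a" using row0[of 0] col0[of 0] by simp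
  then obtain r where r: "a = emb r" using cj_fixed by blast
  define B where "B = mat m m (\<lambda>(i,j). A' $$ (Suc i, Suc j))"
  have B: "B \<in> carrier_mat m m" by (simp add: B_def)
  have A'B: "A' = four_block_mat (mat 1 1 (\<lambda>_. a)) (0\<^sub>m 1 m) (0\<^sub>m m 1) B"
    by (rule eq_matI) (use A' B col0 row0 ca in \<open>auto simp: B_def less_Suc_eq_0_disj\<close>)
  have "adj B = B"
  proof (rule eq_matI)
    fix i j assume "i < dim_row B" "j < dim_col B"
    thus "adj B $$ (i,j) = B $$ (i,j)"
      using A' B index_adj[of "Suc i" A' "Suc j"] by (simp add: B_def)
  qed (use B in auto)
  moreover have "char_poly B = (\<Prod>a\<leftarrow>remove1 a as. [:- a, 1:])"
  proof (rule prod_linear_cancel)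
    have "similar_mat A' A"
      by (rule similar_matI[of _ _ H H ?n]) (use A A' H in \<open>auto simp: A'_def\<close>)
    thus "[:- a, 1:] * char_poly B = (\<Prod>a\<leftarrow>as. [:- a, 1:])"
      using char_poly_similar Suc.prems(3) char_poly_diag_block[OF B, of a] A'B by metis
  qed
  ultimately obtain V d where V: "V \<in> carrier_mat m m" "adj V * V = 1\<^sub>m m"
    "B * V = V * mat_diag m (\<lambda>i. emb (d i))"
    using Suc.IH[OF B] by blast
  \<comment> \<open>\<open>W\<close> extends the diagonalization of the block by one in the corner;
    \<open>H * W\<close> then diagonalizes \<open>A\<close>.\<close>
  define W where "W = four_block_mat (1\<^sub>m 1) (0\<^sub>m 1 m) (0\<^sub>m m 1) V"
  define D where "D = mat_diag ?n (\<lambda>i. emb (case_nat r d i))"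
  have W: "W \<in> carrier_mat ?n ?n" using V four_block_carrier_mat[of "1\<^sub>m 1" 1 1 V m m] by (simp add: W_def)
  have D: "D = four_block_mat (mat 1 1 (\<lambda>_. a)) (0\<^sub>m 1 m) (0\<^sub>m m 1) (mat_diag m (\<lambda>i. emb (d i)))"
    by (rule eq_matI) (auto simp: D_def mat_diag_def r less_Suc_eq_0_disj)
  have "adj W = four_block_mat (1\<^sub>m 1) (0\<^sub>m 1 m) (0\<^sub>m m 1) (adj V)"
    by (rule eq_matI) (use V in \<open>auto simp: W_def less_Suc_eq_0_disj\<close>)
  hence WW: "adj W * W = 1\<^sub>m ?n"
    using V mult_four_block_mat[of "1\<^sub>m 1" 1 1 "0\<^sub>m 1 m" m "0\<^sub>m m 1" m "adj V" "1\<^sub>m 1" 1 "0\<^sub>m 1 m" m "0\<^sub>m m 1" V]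
      four_block_one_mat[of 1 m]
    by (simp add: W_def)
  have "A' * W = W * D"
    unfolding A'B W_def D
    using B V mult_four_block_mat[of "mat 1 1 (\<lambda>_. a)" 1 1 "0\<^sub>m 1 m" m "0\<^sub>m m 1" m B "1\<^sub>m 1" 1 "0\<^sub>m 1 m" m "0\<^sub>m m 1" V]
      mult_four_block_mat[of "1\<^sub>m 1" 1 1 "0\<^sub>m 1 m" m "0\<^sub>m m 1" m V "mat 1 1 (\<lambda>_. a)" 1 "0\<^sub>m 1 m" m "0\<^sub>m m 1" "mat_diag m (\<lambda>i. emb (d i))"]
    by simp
  moreover have "A * H = H * A'"
  proof -
    have "H * A' = (H * H) * (A * H)" using A H(1)
      by (simp add: A'_def assoc_mult_mat[of _ ?n ?n _ ?n _ ?n] mult_carrier_mat[of _ ?n ?n _ ?n])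
    thus ?thesis unfolding H(3) using A H by (simp add: left_mult_one_mat[of _ ?n ?n])
  qed
  ultimately have "A * (H * W) = (H * W) * D"
  proof -
    assume AH: "A' * W = W * D" "A * H = H * A'"
    have Dc: "D \<in> carrier_mat ?n ?n" by (simp add: D_def)
    have "A * (H * W) = A * H * W" using A H W by (simp add: assoc_mult_mat[of _ ?n ?n _ ?n _ ?n])
    also have "\<dots> = H * (A' * W)"
      unfolding AH(2) using A' H W by (simp add: assoc_mult_mat[of _ ?n ?n _ ?n _ ?n])
    also have "\<dots> = H * W * D"
      unfolding AH(1) using H W Dc by (simp add: assoc_mult_mat[of _ ?n ?n _ ?n _ ?n])
    finally show ?thesis .
  qed
  moreover have "adj (H * W) * (H * W) = 1\<^sub>m ?n"
  proof -
    have "adj (H * W) * (H * W) = adj W * ((H * H) * W)"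
      using H(1,2) W
      by (simp add: adj_mult[of _ ?n ?n _ ?n] assoc_mult_mat[of _ ?n ?n _ ?n _ ?n] mult_carrier_mat[of _ ?n ?n _ ?n])
    thus ?thesis using H W WW by simp
  qed
  ultimately show ?case using H W unfolding D_def by (intro exI[of _ "H * W"] exI[of _ "case_nat r d"]) auto
qed

end

section \<open>Square roots of Gram matrices\<close>

lemma pos_square_one: "p * p = 1 \<Longrightarrow> p > 0 \<Longrightarrow> p = 1" for p :: "'a::linordered_field"
  by (auto simp: square_eq_1_iff)

section \<open>Descent to matrices of size two and the Pythagorean property\<close>

context conj_field
begin

text \<open>Padding with a one on the diagonal adds the norm of the first coordinate to the form. It
  lets the splitting hypothesis descend from size \<open>n\<close> to smaller sizes.\<close>

lemma pd_diag_block: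
  assumes B: "B \<in> pd m"
  shows "four_block_mat (mat 1 1 (\<lambda>_. 1)) (0\<^sub>m 1 m) (0\<^sub>m m 1) B \<in> pd (Suc m)" (is "?A \<in> _")
proof -
  have B': "B \<in> carrier_mat m m" "adj B = B" using B by (auto simp: pd_def)
  have A: "?A \<in> carrier_mat (Suc m) (Suc m)"
    using four_block_carrier_mat[of "mat 1 1 (\<lambda>_. 1)" 1 1 B m m] B' by simp
  have "adj ?A = ?A"
  proof (rule eq_matI)
    fix i j assume "i < dim_row ?A" "j < dim_col ?A"
    moreover have "cj (B $$ (j,i)) = B $$ (i,j)" if "i < m" "j < m" for i j
      using B' that by (metis index_adj carrier_matD)
    ultimately show "adj ?A $$ (i,j) = ?A $$ (i,j)"
      using B' by (auto simp: less_Suc_eq_0_disj)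
  qed (use A B'(1) in auto)
  moreover have "\<exists>r>0. map_vec cj v \<bullet> (?A *\<^sub>v v) = emb r"
    if v: "v \<in> carrier_vec (Suc m)" "v \<noteq> 0\<^sub>v (Suc m)" for v
  proof -
    define w where "w = vec m (\<lambda>i. v $ Suc i)"
    have w: "w \<in> carrier_vec m" by (simp add: w_def)
    have w_nth: "w $ i = v $ Suc i" if "i < m" for i using that by (simp add: w_def)
    have row: "(?A *\<^sub>v v) $ i = (if i = 0 then v $ 0 else (B *\<^sub>v w) $ (i - 1))" if "i < Suc m" for i
      using that v B' w
      by (cases i) (auto simp: scalar_prod_def w_def sum.atLeast0_lessThan_Suc_shift
          simp del: sum.op_ivl_Suc)
    have form: "map_vec cj v \<bullet> (?A *\<^sub>v v) = emb (nrm (v $ 0)) + map_vec cj w \<bullet> (B *\<^sub>v w)"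
      using v A B' w row
      by (simp add: scalar_prod_def[of "map_vec cj v"] scalar_prod_def[of "map_vec cj w"]
          sum.atLeast0_lessThan_Suc_shift w_nth emb_nrm mult.commute del: sum.op_ivl_Suc index_mult_mat_vec)
    show ?thesis
    proof (cases "w = 0\<^sub>v m")
      case True
      have "v $ 0 \<noteq> 0"
      proof
        assume "v $ 0 = 0"
        have "v = 0\<^sub>v (Suc m)"
        proof (rule eq_vecI)
          fix i assume "i < dim_vec (0\<^sub>v (Suc m) :: 'f vec)"
          thus "v $ i = 0\<^sub>v (Suc m) $ i"
            using \<open>v $ 0 = 0\<close> arg_cong[OF True, of "\<lambda>w. w $ (i - 1)"] by (cases i) (auto simp: w_def)
        qed (use v in simp)
        thus False using v by simp
      qed
      moreover have "map_vec cj w \<bullet> (B *\<^sub>v w) = 0"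
        using B' by (auto simp: True scalar_prod_def)
      ultimately show ?thesis using form nrm_pos by auto
    next
      case False
      then obtain r where "r > 0" "map_vec cj w \<bullet> (B *\<^sub>v w) = emb r"
        using B w by (auto simp: pd_def)
      thus ?thesis using form nrm_nonneg[of "v $ 0"]
        by (intro exI[of _ "nrm (v $ 0) + r"]) (simp add: emb.hom_add add_nonneg_pos)
    qed
  qed
  ultimately show ?thesis using A by (simp add: pd_def)
qed

lemma splits_smaller:
  assumes "\<And>A. A \<in> pd (Suc m) \<Longrightarrow> splits_linear (char_poly A)" and B: "B \<in> pd m"
  shows "splits_linear (char_poly B)"
proof -
  have B': "B \<in> carrier_mat m m" using B by (simp add: pd_def)
  let ?A = "four_block_mat (mat 1 1 (\<lambda>_. 1)) (0\<^sub>m 1 m) (0\<^sub>m m 1) B"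
  have A: "?A \<in> pd (Suc m)" using pd_diag_block[OF B] .
  hence "?A \<in> carrier_mat (Suc m) (Suc m)" by (simp only: pd_def mem_Collect_eq)
  then obtain as where "char_poly ?A = (\<Prod>a\<leftarrow>as. [:- a, 1:])"
    by (rule char_poly_splits[OF _ assms(1)[OF A]])
  hence "char_poly B = (\<Prod>a\<leftarrow>remove1 1 as. [:- a, 1:])"
    using prod_linear_cancel char_poly_diag_block[OF B', of 1] by metis
  thus ?thesis unfolding splits_linear_def by (metis smult_1_left)
qed

lemma splits_le:
  assumes "m \<le> n" "\<And>A. A \<in> pd n \<Longrightarrow> splits_linear (char_poly A)" "B \<in> pd m"
  shows "splits_linear (char_poly B)"
  using assms(1,3)
proof (induction arbitrary: B rule: inc_induct)
  case base
  thus ?case using assms(2) by simp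
next
  case (step k)
  show ?case by (rule splits_smaller[OF step.IH step.prems])
qed

text \<open>Conjugation fixes \<open>z * z\<close>, so it sends \<open>z\<close> to \<open>z\<close>
  or \<open>- z\<close>. In the second case \<open>nrm z = - s\<close>, which is at most zero and
  forces \<open>z = 0\<close>.\<close>

lemma real_if_square:
  assumes "z * z = emb s" "s \<ge> 0"
  obtains r where "z = emb r"
proof -
  have "cj z * cj z = emb s" using assms(1) by (metis cj.hom_mult cj_emb)
  hence "(z - cj z) * (z + cj z) = 0" using assms(1) by (simp add: algebra_simps)
  hence "cj z = z \<or> cj z = - z" by (auto simp: eq_neg_iff_add_eq_0 add.commute)
  moreover have "z = 0" if "cj z = - z"
  proof (rule ccontr)
    assume "z \<noteq> 0"
    have "emb (nrm z) = emb (- s)" using assms(1) that by (simp add: emb_nrm emb.hom_uminus)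
    hence "nrm z = - s" by (simp only: emb.eq_iff)
    thus False using nrm_pos[OF \<open>z \<noteq> 0\<close>] assms(2) by simp
  qed
  ultimately show thesis using that cj_fixed by (metis neg_equal_zero cj.hom_zero)
qed

text \<open>The characteristic equation, obtained by eliminating either coordinate of an eigenvector
  from the two row equations and cancelling a coordinate that is nonzero.\<close>

lemma eigenvalue_2:
  fixes A :: "'f mat"
  assumes A: "A \<in> carrier_mat 2 2" and "eigenvalue A \<mu>"
  shows "(\<mu> - A $$ (0,0)) * (\<mu> - A $$ (1,1)) = A $$ (0,1) * A $$ (1,0)"
proof -
  obtain v where v: "v \<in> carrier_vec 2" "v \<noteq> 0\<^sub>v 2" "A *\<^sub>v v = \<mu> \<cdot>\<^sub>v v"
    using assms by (auto simp: eigenvalue_def eigenvector_def)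
  have "(\<mu> \<cdot>\<^sub>v v) $ i = A $$ (i,0) * v $ 0 + A $$ (i,1) * v $ 1" if "i < 2" for i
    unfolding v(3)[symmetric] using A v(1) that by (simp add: scalar_prod_def numeral_2_eq_2)
  from this[of 0] this[of 1]
  have e: "(\<mu> - A $$ (0,0)) * v $ 0 = A $$ (0,1) * v $ 1" "(\<mu> - A $$ (1,1)) * v $ 1 = A $$ (1,0) * v $ 0"
    using v(1) by (auto simp: algebra_simps)
  have ez: "((\<mu> - A $$ (0,0)) * (\<mu> - A $$ (1,1)) - A $$ (0,1) * A $$ (1,0)) * v $ i = 0" (is "?e * _ = 0")
    if i: "i < 2" for i
  proof -
    consider "i = 0" | "i = 1" using i by (metis One_nat_def less_2_cases)
    thus ?thesis
    proof cases
      case 1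
      have "(\<mu> - A $$ (0,0)) * (\<mu> - A $$ (1,1)) * v $ 0 = (\<mu> - A $$ (1,1)) * (A $$ (0,1) * v $ 1)"
        unfolding e(1)[symmetric] by (simp only: ac_simps)
      also have "\<dots> = A $$ (0,1) * ((\<mu> - A $$ (1,1)) * v $ 1)" by (simp only: ac_simps)
      finally show ?thesis unfolding e(2) using 1 by (simp add: left_diff_distrib)
    next
      case 2
      have "(\<mu> - A $$ (0,0)) * (\<mu> - A $$ (1,1)) * v $ 1 = (\<mu> - A $$ (0,0)) * (A $$ (1,0) * v $ 0)"
        unfolding e(2)[symmetric] by (simp only: ac_simps)
      also have "\<dots> = A $$ (1,0) * ((\<mu> - A $$ (0,0)) * v $ 0)" by (simp only: ac_simps)
      finally show ?thesis unfolding e(1) using 2 by (simp add: left_diff_distrib)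
    qed
  qed
  obtain i where i: "i < 2" "v $ i \<noteq> 0"
    using v(1,2) by (metis eq_vecI index_zero_vec carrier_vecD)
  from ez[OF i(1)] have "?e = 0 \<or> v $ i = 0" by (rule divisors_zero)
  hence "?e = 0" using i(2) by simp
  thus ?thesis by (simp only: right_minus_eq)
qed

text \<open>A suitable positive definite matrix with off-diagonal entry \<open>q/2\<close> and diagonal entries differing
  by \<open>|x|\<close> has a characteristic polynomial of discriminant \<open>x\<^sup>2 + |q|\<^sup>2\<close>.\<close>

lemma pythagorean_step:
  assumes splits: "\<And>A. A \<in> pd 2 \<Longrightarrow> splits_linear (char_poly A)"
  shows "\<exists>c. c * c = x * x + nrm q"
proof -
  define p where "p = q * emb (1/2)"
  define h where "h = nrm p"
  define d where "d = 1 + h"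
  \<comment> \<open>\<open>f 0\<close> is the Schur complement for which \<open>C\<close>,
    \<open>f\<close> and the adjoint of \<open>C\<close> multiply to a matrix with diagonal
    \<open>\<bar>x\<bar> + d\<close>, \<open>d\<close> and off-diagonal entry \<open>p\<close>. The
    choice \<open>d = 1 + h\<close> makes \<open>h / d < d\<close>, so \<open>f\<close> is
    positive.\<close>
  define f where "f i = (if i = 0 then \<bar>x\<bar> + d - h / d else d)" for i :: nat
  have h0: "h \<ge> 0" by (simp add: h_def)
  have d0: "d > 0" using h0 by (simp add: d_def)
  have "h / d < d"
  proof -
    have "h < d * d" using h0 by (simp add: d_def algebra_simps add_pos_nonneg)
    thus ?thesis using d0 by (simp add: divide_less_eq)
  qed
  hence "\<bar>x\<bar> + (d - h / d) > 0" by (intro add_nonneg_pos) auto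
  hence f: "f i > 0" for i using d0 by (simp add: f_def add_diff_eq)
  define C where "C = addrow_mat 2 (p * emb (1 / d)) 0 1"
  define A where "A = C * mat_diag 2 (\<lambda>i. emb (f i)) * adj C"
  have C: "C \<in> carrier_mat 2 2" "det C \<noteq> 0" by (simp_all add: C_def det_addrow_mat)
  have A: "A \<in> pd 2" unfolding A_def by (intro pd_congruence pd_diag f C)
  hence A': "A \<in> carrier_mat 2 2" by (simp add: pd_def)
  have entry: "A $$ (i,j) = (\<Sum>k<2. C $$ (i,k) * emb (f k) * cj (C $$ (j,k)))" if "i < 2" "j < 2" for i j
    using C that unfolding A_def
    by (simp add: mat_diag_mult_right[of _ 2 2] scalar_prod_def lessThan_atLeast0)
  have dd: "emb (1/d) * emb d = 1" using d0
    by (metis emb.hom_mult emb.hom_one less_irrefl nonzero_eq_divide_eq)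
  have A00: "A $$ (0,0) = emb (\<bar>x\<bar> + d)"
  proof -
    have "A $$ (0,0) = emb (f 0) + (p * cj p) * emb (1/d) * (emb (1/d) * emb d)"
      using entry[of 0 0] by (simp add: C_def numeral_2_eq_2 f_def cj.hom_mult ac_simps)
    also have "\<dots> = emb (f 0 + h * (1 / d))" unfolding dd h_def emb.hom_add emb.hom_mult emb_nrm by simp
    finally show ?thesis by (simp add: f_def)
  qed
  have A01: "A $$ (0,1) = p"
    using entry[of 0 1] dd by (simp add: C_def numeral_2_eq_2 f_def ac_simps)
  have A10: "A $$ (1,0) = cj p"
    using A A' A01 index_adj[of 1 A 0] by (simp add: pd_def)
  have A11: "A $$ (1,1) = emb d"
    using entry[of 1 1] by (simp add: C_def numeral_2_eq_2 f_def)
  obtain as where as: "char_poly A = (\<Prod>a\<leftarrow>as. [:- a, 1:])"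
    using char_poly_splits[OF A' splits[OF A]] by blast
  have "as \<noteq> []" using degree_monic_char_poly[OF A'] as by auto
  then obtain \<mu> bs where "as = \<mu> # bs" by (cases as) auto
  hence "eigenvalue A \<mu>" using eigenvalue_root_char_poly[OF A'] as by simp
  hence "(\<mu> - A $$ (0,0)) * (\<mu> - A $$ (1,1)) = A $$ (0,1) * A $$ (1,0)" using eigenvalue_2 A' by blast
  hence \<mu>: "(\<mu> - emb d - emb \<bar>x\<bar>) * (\<mu> - emb d) = emb h"
    unfolding A00 A11 A01 A10 h_def emb_nrm emb.hom_add by (simp add: algebra_simps)
  \<comment> \<open>Twice the eigenvalue minus the trace, hence a square root of the
    discriminant.\<close>
  define z where "z = 2 * (\<mu> - emb d) - emb \<bar>x\<bar>"
  have "z * z = 4 * ((\<mu> - emb d - emb \<bar>x\<bar>) * (\<mu> - emb d)) + emb \<bar>x\<bar> * emb \<bar>x\<bar>"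
    by (simp add: z_def algebra_simps)
  also have "\<dots> = emb (4 * h + \<bar>x\<bar> * \<bar>x\<bar>)" unfolding \<mu> by (simp only: emb.hom_add emb.hom_mult emb.hom_numeral)
  also have "4 * h + \<bar>x\<bar> * \<bar>x\<bar> = x * x + nrm q" by (simp add: h_def p_def nrm_mult nrm_emb)
  finally have z: "z * z = emb (x * x + nrm q)" .
  then obtain r where "z = emb r" using real_if_square[OF z] by (auto simp: add_nonneg_nonneg)
  hence "emb (r * r) = emb (x * x + nrm q)" using z by (simp add: emb.hom_mult)
  thus ?thesis by (simp only: emb.eq_iff) blast
qed

text \<open>The previous lemma is used twice: first with zero for its base field argument, to write
  \<open>nrm x\<close> as a square \<open>b * b\<close>, then with \<open>b\<close>.\<close>

lemma pythagorean:
  assumes splits: "\<And>A. A \<in> pd 2 \<Longrightarrow> splits_linear (char_poly A)"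
  shows "\<exists>c. c * c = nrm x + nrm y"
proof -
  obtain b where "b * b = nrm x" using pythagorean_step[OF splits, of 0 x] by auto
  thus ?thesis using pythagorean_step[OF splits, of b y] by simp
qed

end

section \<open>Unitary diagonalization and positive definite roots\<close>

locale n_real = conj_field +
  fixes n :: nat
  assumes n2: "n \<ge> 2" and splits: "A \<in> pd n \<Longrightarrow> splits_linear (char_poly A)"
begin

abbreviation diag :: "(nat \<Rightarrow> 'a) \<Rightarrow> 'b mat" where
  "diag d \<equiv> mat_diag n (\<lambda>i. emb (d i))"

lemmas assoc_mult_square [simp] = assoc_mult_mat[of _ n n _ n _ n]

lemmas mult_square_carrier [simp] = mult_carrier_mat[of _ n n _ n]

lemma sum_square:
  fixes m :: nat
  shows "\<exists>c\<ge>0. c * c = (\<Sum>i<m. nrm (f i))"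
  by (intro sum_nrm_square pythagorean splits_le[OF n2 splits]) auto

lemma pd_unitary:
  assumes A: "A \<in> pd n"
  obtains P d where "P \<in> carrier_mat n n" "adj P * P = 1\<^sub>m n" "P * adj P = 1\<^sub>m n"
    "A * P = P * diag d" "A = P * diag d * adj P" "\<And>i. i < n \<Longrightarrow> d i > 0"
proof -
  have A': "A \<in> carrier_mat n n" "adj A = A" using A by (auto simp: pd_def)
  obtain as where as: "char_poly A = (\<Prod>a\<leftarrow>as. [:- a, 1:])"
    using char_poly_splits[OF A'(1) splits[OF A]] by blast
  obtain P d where P: "P \<in> carrier_mat n n" "adj P * P = 1\<^sub>m n" "A * P = P * diag d"
    using spectral[OF _ A' as] pythagorean splits_le[OF n2 splits] by blast
  have P': "P * adj P = 1\<^sub>m n" using mat_mult_left_right_inverse[OF _ P(1,2)] P(1) by simp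
  have "P * diag d * adj P = A * (P * adj P)" using P A' by (simp add: P(3)[symmetric])
  hence eq: "A = P * diag d * adj P" using P' A' by simp
  \<comment> \<open>The diagonal matrix is congruent to \<open>A\<close>, hence positive definite;
    evaluating its form at unit vectors shows that the eigenvalues are positive.\<close>
  have "diag d = adj P * P * diag d" unfolding P(2) by (simp add: left_mult_one_mat[of _ n n])
  also have "\<dots> = adj P * A * P" using P(1) A' by (simp add: P(3)[symmetric])
  also have "\<dots> \<in> pd n"
  proof -
    have "det P \<noteq> 0" using P(1,2) det_mult[of "adj P" n P] by auto
    thus ?thesis using pd_congruence[OF A, of "adj P"] P by (simp add: det_adj)
  qed
  finally have D: "diag d \<in> pd n" .
  have "d i > 0" if i: "i < n" for i
  proof -
    have "unit_vec n i \<noteq> (0\<^sub>v n :: 'b vec)" using i by simp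
    then obtain r where r: "r > 0" "map_vec cj (unit_vec n i) \<bullet> (diag d *\<^sub>v unit_vec n i) = emb r"
      using D by (auto simp: pd_def)
    have "map_vec cj (unit_vec n i) = unit_vec n i"
      by (rule eq_vecI) (auto simp: unit_vec_def)
    moreover have "diag d *\<^sub>v unit_vec n i = emb (d i) \<cdot>\<^sub>v unit_vec n i"
      using i by (intro eq_vecI) (auto simp: mat_diag_def)
    ultimately have "emb r = emb (d i)" using r(2) i by simp
    thus ?thesis using r(1) by (simp only: emb.eq_iff)
  qed
  thus thesis using that P P' eq by blast
qed

definition L :: "'b mat set" where
  "L = pd n \<inter> SL n"

lemma gram_diagonal:
  assumes "X \<in> carrier_mat n n" "i < n"
  shows "(X * adj X) $$ (i,i) = emb (\<Sum>k<n. nrm (X $$ (i,k)))"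
  using assms by (simp add: scalar_prod_def lessThan_atLeast0 emb.hom_sum emb_nrm)

text \<open>A positive element of \<open>R\<close> is not known to be a square here. But the
  diagonalized Gram matrix is itself a Gram matrix, of \<open>adj P * g\<close>, so its diagonal
  entries are sums of norms and therefore squares.\<close>

lemma sqrt_exists:
  assumes g: "g \<in> SL n"
  obtains C where "C \<in> L" "C * C = g * adj g"
proof -
  have g': "g \<in> carrier_mat n n" "det g = 1" using g by (auto simp: SL_def)
  obtain P d where P: "P \<in> carrier_mat n n" "adj P * P = 1\<^sub>m n" "P * adj P = 1\<^sub>m n"
    and eq: "g * adj g = P * diag d * adj P" and d: "\<And>i. i < n \<Longrightarrow> d i > 0"
    using pd_unitary[OF pd_gram[OF g]] by metis
  have "\<exists>c>0. c * c = d i" if i: "i < n" for i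
  proof -
    let ?X = "adj P * g"
    have "diag d = adj P * P * diag d * (adj P * P)" unfolding P(2)
      by (simp add: left_mult_one_mat[of _ n n] right_mult_one_mat[of _ n n])
    also have "\<dots> = adj P * (P * diag d * adj P) * P" using P(1) by simp
    also have "\<dots> = ?X * adj ?X" unfolding eq[symmetric] using g' P(1) by (simp add: adj_mult[of _ n n _ n])
    finally have "diag d $$ (i,i) = (?X * adj ?X) $$ (i,i)" by simp
    moreover have "?X \<in> carrier_mat n n" using g' P(1) by simp
    ultimately have "emb (d i) = emb (\<Sum>k<n. nrm (?X $$ (i,k)))"
      using i gram_diagonal by (simp add: mat_diag_def)
    hence "d i = (\<Sum>k<n. nrm (?X $$ (i,k)))" by (simp only: emb.eq_iff)
    moreover obtain c where "c \<ge> 0" "c * c = (\<Sum>k<n. nrm (?X $$ (i,k)))"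
      using sum_square[where m = n and f = "\<lambda>k. ?X $$ (i,k)"] by blast
    ultimately show ?thesis using d[OF i] by (intro exI[of _ c]) (auto simp: order.order_iff_strict)
  qed
  then obtain c where c: "\<And>i. i < n \<Longrightarrow> c i > 0 \<and> c i * c i = d i" by metis
  define C where "C = P * diag c * adj P"
  have C: "C \<in> carrier_mat n n" using P by (simp add: C_def)
  have "C * C = P * (diag c * (adj P * P) * diag c) * adj P"
    using P(1) by (simp add: C_def)
  also have "diag c * (adj P * P) * diag c = mat_diag n (\<lambda>i. emb (c i) * emb (c i))"
    unfolding P(2) by (simp add: right_mult_one_mat[of _ n n])
  also have "\<dots> = diag d"
    by (rule eq_matI) (use c in \<open>auto simp: mat_diag_def emb.hom_mult[symmetric]\<close>)
  finally have CC: "C * C = g * adj g" using eq by simp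
  have "det P * det (adj P) = 1" using P(1,3) by (metis adj_carrier det_mult det_one)
  hence "det C = det (diag c)" using P(1) by (simp add: C_def det_mult[of _ n])
  also have "\<dots> = emb (\<Prod>i<n. c i)" by (simp add: det_mat_diag emb.hom_prod)
  finally have dC: "det C = emb (\<Prod>i<n. c i)" .
  \<comment> \<open>The determinant of the root squares to one and is a product of positive
    elements, so it equals one.\<close>
  have "det C * det C = 1" using arg_cong[OF CC, of det] C g' by (simp add: det_mult[of _ n] det_adj)
  hence "emb ((\<Prod>i<n. c i) * (\<Prod>i<n. c i)) = emb 1" unfolding dC by (simp add: emb.hom_mult)
  hence "(\<Prod>i<n. c i) * (\<Prod>i<n. c i) = 1" by (simp only: emb.eq_iff)
  moreover have "(\<Prod>i<n. c i) > 0" using c by (intro prod_pos) auto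
  ultimately have "(\<Prod>i<n. c i) = 1" by (rule pos_square_one)
  hence "det C = 1" using dC by simp
  moreover have "C \<in> pd n"
  proof -
    have "det P \<noteq> 0" using \<open>det P * det (adj P) = 1\<close> by auto
    thus ?thesis unfolding C_def using c by (intro pd_congruence pd_diag P(1)) auto
  qed
  ultimately show thesis using that CC C by (auto simp: L_def SL_def)
qed

text \<open>Let \<open>P\<close> and \<open>Q\<close> diagonalize the two roots. Equality of the
  squares says that \<open>Y = adj P * Q\<close> intertwines the squared eigenvalues. At each
  nonzero entry of \<open>Y\<close> the squares agree, hence so do the positive eigenvalues, and
  \<open>Y\<close> intertwines the roots themselves.\<close>

lemma sqrt_unique:
  assumes C: "C \<in> pd n" and C': "C' \<in> pd n" and eq: "C * C = C' * C'"
  shows "C = C'"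
proof -
  obtain P c where P: "P \<in> carrier_mat n n" "adj P * P = 1\<^sub>m n" "P * adj P = 1\<^sub>m n"
    "C = P * diag c * adj P" and c: "\<And>i. i < n \<Longrightarrow> c i > 0"
    using pd_unitary[OF C] by metis
  obtain Q d where Q: "Q \<in> carrier_mat n n" "adj Q * Q = 1\<^sub>m n" "Q * adj Q = 1\<^sub>m n"
    "C' * Q = Q * diag d" and d: "\<And>i. i < n \<Longrightarrow> d i > 0"
    using pd_unitary[OF C'] by metis
  have car: "C \<in> carrier_mat n n" "C' \<in> carrier_mat n n" using C C' by (auto simp: pd_def)
  have Pc: "diag c * (adj P * X) = adj P * (C * X)" if "X \<in> carrier_mat n n" for X
  proof -
    have "adj P * (C * X) = (adj P * P) * (diag c * (adj P * X))" using P(1) that by (simp add: P(4))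
    thus ?thesis unfolding P(2) using P(1) that by simp
  qed
  have Qd: "C' * (Q * X) = Q * (diag d * X)" if "X \<in> carrier_mat n n" for X
  proof -
    have "C' * (Q * X) = (C' * Q) * X" using Q(1) car that by simp
    thus ?thesis unfolding Q(4) using Q(1) that by simp
  qed
  define Y where "Y = adj P * Q"
  have Y: "Y \<in> carrier_mat n n" using P Q by (simp add: Y_def)
  have "diag c * (diag c * Y) = adj P * (C * (C * Q))"
    using P(1) Q(1) car by (simp add: Pc Y_def)
  also have "C * (C * Q) = (C * C) * Q" using Q(1) car by simp
  also have "\<dots> = C' * (C' * Q)" unfolding eq using Q(1) car by simp
  also have "adj P * (C' * (C' * Q)) = Y * (diag d * diag d)"
    using P(1) Q(1) car unfolding Q(4) by (simp add: Qd Y_def del: mat_diag_diag)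
  finally have YY: "diag c * (diag c * Y) = Y * (diag d * diag d)" .
  have "diag c * Y = Y * diag d"
  proof (rule eq_matI)
    fix i j assume "i < dim_row (Y * diag d)" "j < dim_col (Y * diag d)"
    hence ij: "i < n" "j < n" using Y by auto
    have "emb (c i) * (emb (c i) * Y $$ (i,j)) = Y $$ (i,j) * (emb (d j) * emb (d j))"
      using arg_cong[OF YY, of "\<lambda>M. M $$ (i,j)"] ij Y
      by (simp add: mat_diag_mult_left[of _ n n] mat_diag_mult_right[of _ n n])
    hence "emb (c i * c i - d j * d j) * Y $$ (i,j) = 0"
      by (simp add: emb.hom_mult emb.hom_minus algebra_simps)
    hence "c i * c i = d j * d j \<or> Y $$ (i,j) = 0"
      by (metis emb.hom_0_iff eq_iff_diff_eq_0 mult_eq_0_iff)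
    hence "c i = d j \<or> Y $$ (i,j) = 0"
      using c[OF ij(1)] d[OF ij(2)] by (metis less_asym neg_0_less_iff_less square_eq_iff)
    thus "(diag c * Y) $$ (i,j) = (Y * diag d) $$ (i,j)"
      using ij Y by (auto simp: mat_diag_mult_left[of _ n n] mat_diag_mult_right[of _ n n])
  qed (use Y in \<open>auto simp: mat_diag_def\<close>)
  hence "adj P * (C * Q) = adj P * (C' * Q)"
    using P(1) Q(1) car by (simp add: Pc[symmetric] Q(4) Y_def)
  hence "P * (adj P * (C * Q)) * adj Q = P * (adj P * (C' * Q)) * adj Q" by simp
  hence "(P * adj P) * C * (Q * adj Q) = (P * adj P) * C' * (Q * adj Q)"
    using P(1) Q(1) car by simp
  thus ?thesis unfolding P(3) Q(3) using car by simp
qed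

end

section \<open>The loop of positive definite matrices\<close>

context n_real
begin

section \<open>The action of G on positive definite matrices\<close>

definition U :: "'b mat set" where
  "U = {A \<in> SL n. adj A * A = 1\<^sub>m n}"

text \<open>For \<open>g\<close> in \<open>SL n\<close> and \<open>b\<close> in \<open>L\<close>,
  this is the positive definite factor in the polar decomposition of \<open>g * b\<close>. The
  product is bracketed to the right, in the form to which \<open>assoc_mult_square\<close>
  rewrites.\<close>

definition act :: "'b mat \<Rightarrow> 'b mat \<Rightarrow> 'b mat" where
  "act g b = (THE C. C \<in> L \<and> C * C = g * (b * (b * adj g)))"

lemma L_I: "A \<in> pd n \<Longrightarrow> A \<in> SL n \<Longrightarrow> A \<in> L"
  by (simp add: L_def)

lemma L_pd: "A \<in> L \<Longrightarrow> A \<in> pd n"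
  by (simp add: L_def)

lemma L_SL: "A \<in> L \<Longrightarrow> A \<in> SL n"
  by (simp add: L_def)

lemma adj_L [simp]: "A \<in> L \<Longrightarrow> adj A = A"
  by (simp add: L_def pd_def)

lemma L_carrier [simp]: "A \<in> L \<Longrightarrow> A \<in> carrier_mat n n"
  by (rule SL_carrier[OF L_SL])

declare SL_carrier [simp]

lemma one_in_L [simp]: "1\<^sub>m n \<in> L"
  by (rule L_I[OF one_in_pd one_in_SL])

lemma adj_mult_square: "A \<in> carrier_mat n n \<Longrightarrow> B \<in> carrier_mat n n \<Longrightarrow> adj (A * B) = adj B * adj A"
  by (rule adj_mult)

lemma L_congruence:
  assumes A: "A \<in> L" and g: "g \<in> SL n"
  shows "g * (A * adj g) \<in> L"
proof -
  have "det g \<noteq> 0" using g by (simp add: SL_def del: SL_carrier)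
  hence "g * A * adj g \<in> pd n" using pd_congruence[OF L_pd[OF A]] g by simp
  hence "g * (A * adj g) \<in> pd n" using A g by simp
  moreover have "g * (A * adj g) \<in> SL n" by (intro mult_in_SL adj_in_SL g L_SL A)
  ultimately show ?thesis by (rule L_I)
qed

lemma act_eqI:
  assumes "C \<in> L" "C * C = g * (b * (b * adj g))"
  shows "act g b = C"
  unfolding act_def
proof (rule the_equality)
  fix C' assume "C' \<in> L \<and> C' * C' = g * (b * (b * adj g))"
  thus "C' = C" using sqrt_unique[of C' C] assms by (simp add: L_pd)
qed (use assms in simp)

lemma act_L: "g \<in> SL n \<Longrightarrow> b \<in> L \<Longrightarrow> act g b \<in> L"
  and act_square: "g \<in> SL n \<Longrightarrow> b \<in> L \<Longrightarrow> act g b * act g b = g * (b * (b * adj g))"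
proof -
  assume g: "g \<in> SL n" and b: "b \<in> L"
  obtain C where "C \<in> L" "C * C = g * b * adj (g * b)"
    using sqrt_exists[of "g * b"] mult_in_SL g L_SL[OF b] by blast
  hence "C \<in> L" "C * C = g * (b * (b * adj g))" using g b by (simp_all add: adj_mult_square)
  thus "act g b \<in> L" "act g b * act g b = g * (b * (b * adj g))" using act_eqI by auto
qed

lemma act_mult:
  assumes "g \<in> SL n" "h \<in> SL n" "b \<in> L"
  shows "act (g * h) b = act g (act h b)"
proof (rule act_eqI)
  have h: "act h b \<in> L" using act_L assms by blast
  have "act g (act h b) * act g (act h b) = g * (act h b * (act h b * adj g))"
    by (rule act_square[OF assms(1) h])
  also have "\<dots> = g * (act h b * act h b) * adj g" using h assms by simp
  also have "\<dots> = g * h * (b * (b * adj (g * h)))"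
    unfolding act_square[OF assms(2,3)] using assms by (simp add: adj_mult_square)
  finally show "act g (act h b) * act g (act h b) = g * h * (b * (b * adj (g * h)))" .
qed (use assms act_L in blast)

lemma act_one [simp]: "b \<in> L \<Longrightarrow> act (1\<^sub>m n) b = b"
  by (rule act_eqI) (auto simp: right_mult_one_mat[of _ n n] left_mult_one_mat[of _ n n])

lemma act_on_one: "a \<in> L \<Longrightarrow> act a (1\<^sub>m n) = a"
  by (rule act_eqI) (auto simp: left_mult_one_mat[of _ n n])

lemma act_cancel:
  assumes "g \<in> SL n" "h \<in> SL n" "g * h = 1\<^sub>m n" "b \<in> L"
  shows "act g (act h b) = b"
  using assms act_mult[OF assms(1,2,4)] by simp

section \<open>The loop product and its divisions\<close>

abbreviation mul :: "'b mat \<Rightarrow> 'b mat \<Rightarrow> 'b mat" where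
  "mul \<equiv> transversal_mult L U"

text \<open>If \<open>A * B = C * d\<close> with \<open>d\<close> unitary, multiplying by the
  adjoint removes \<open>d\<close> and leaves \<open>C * C\<close>. Conversely, \<open>d\<close> is
  recovered as the inverse of \<open>C\<close> times \<open>A * B\<close>, and the equation of
  squares makes it unitary. So both descriptions single out the same matrix.\<close>

lemma mul_eq_act:
  assumes A: "A \<in> L" and B: "B \<in> L"
  shows "mul A B = act A B"
proof -
  have "(\<exists>d\<in>U. A * B = C * d) \<longleftrightarrow> C * C = A * (B * (B * adj A))" if C: "C \<in> L" for C
  proof
    assume "\<exists>d\<in>U. A * B = C * d"
    then obtain d where d: "d \<in> SL n" "adj d * d = 1\<^sub>m n" "A * B = C * d" by (auto simp: U_def)
    have dd: "d * adj d = 1\<^sub>m n" using mat_mult_left_right_inverse[OF _ _ d(2)] d(1) by simp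
    have "A * (B * (B * adj A)) = (A * B) * adj (A * B)" using A B by (simp add: adj_mult_square)
    also have "\<dots> = C * ((d * adj d) * C)" unfolding d(3) using C d(1) by (simp add: adj_mult_square)
    finally show "C * C = A * (B * (B * adj A))" unfolding dd using C by (simp add: left_mult_one_mat[of _ n n])
  next
    assume eq: "C * C = A * (B * (B * adj A))"
    obtain C' where C': "C' \<in> SL n" "C * C' = 1\<^sub>m n" "C' * C = 1\<^sub>m n"
      using SL_inverse[OF L_SL[OF C]] by blast
    define d where "d = C' * (A * B)"
    have d: "d \<in> SL n" unfolding d_def by (intro mult_in_SL C' L_SL[OF A] L_SL[OF B])
    have "C * d = (C * C') * (A * B)" using C C'(1) A B by (simp add: d_def)
    hence Cd: "A * B = C * d" unfolding C'(2) using A B by (simp add: left_mult_one_mat[of _ n n])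
    have "adj C' * C = 1\<^sub>m n" using C C' adj_mult_square[of C C'] by simp
    have "d * adj d = C' * (A * (B * (B * adj A))) * adj C'"
      using C' A B by (simp add: d_def adj_mult_square)
    also have "\<dots> = (C' * C) * (C * adj C')" unfolding eq[symmetric] using C C'(1) by simp
    also have "C * adj C' = adj (C' * C)" using C C'(1) by (simp add: adj_mult_square)
    finally have "d * adj d = 1\<^sub>m n" unfolding C'(3) by simp
    hence "adj d * d = 1\<^sub>m n" using mat_mult_left_right_inverse[of d n "adj d"] d by simp
    thus "\<exists>d\<in>U. A * B = C * d" using d Cd by (auto simp: U_def)
  qed
  hence "mul A B = (THE C. C \<in> L \<and> C * C = A * (B * (B * adj A)))"
    unfolding transversal_mult_def by (intro arg_cong[of _ _ The] ext) blast
  thus ?thesis by (simp only: act_def)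
qed

lemma mul_closed: "a \<in> L \<Longrightarrow> b \<in> L \<Longrightarrow> mul a b \<in> L"
  by (simp add: mul_eq_act act_L L_SL)

lemma mul_one: "a \<in> L \<Longrightarrow> mul (1\<^sub>m n) a = a" "a \<in> L \<Longrightarrow> mul a (1\<^sub>m n) = a"
  by (simp_all add: mul_eq_act act_on_one)

lemma L_inverse:
  assumes "a \<in> L"
  obtains a' where "a' \<in> SL n" "a * a' = 1\<^sub>m n" "a' * a = 1\<^sub>m n" "adj a' = a'"
proof -
  obtain a' where a': "a' \<in> SL n" "a * a' = 1\<^sub>m n" "a' * a = 1\<^sub>m n"
    using SL_inverse[OF L_SL[OF assms]] by blast
  have "adj a' * a = 1\<^sub>m n" using assms a' adj_mult_square[of a a'] by simp
  hence "adj a' * a * a' = a'" using a' by (simp add: left_mult_one_mat[of _ n n] del: assoc_mult_square assoc_mult_mat)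
  moreover have "adj a' * a * a' = adj a' * (a * a')" using assms a'(1) by simp
  ultimately have "adj a' = a'" unfolding a'(2) using a'(1) by (simp add: right_mult_one_mat[of _ n n])
  thus thesis using that a' by blast
qed

lemma left_division:
  assumes "a \<in> L" "b \<in> L"
  shows "\<exists>!x. x \<in> L \<and> mul a x = b"
proof -
  obtain a' where a': "a' \<in> SL n" "a * a' = 1\<^sub>m n" "a' * a = 1\<^sub>m n"
    using L_inverse assms(1) by blast
  show ?thesis
  proof (rule ex1I[of _ "act a' b"])
    show "act a' b \<in> L \<and> mul a (act a' b) = b"
      using assms a' by (simp add: act_L mul_eq_act L_SL act_cancel)
    fix x assume "x \<in> L \<and> mul a x = b"
    thus "x = act a' b" using assms a' act_cancel[of a' a x] by (auto simp: mul_eq_act L_SL)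
  qed
qed

lemma mul_left_cancel: "a \<in> L \<Longrightarrow> x \<in> L \<Longrightarrow> y \<in> L \<Longrightarrow> mul a x = mul a y \<Longrightarrow> x = y"
  using left_division[of a "mul a y"] mul_closed by blast

text \<open>Squaring turns \<open>y \<circ> a = b\<close> into \<open>y a\<^sup>2 y = b\<^sup>2\<close>, that is, \<open>(a y a)\<^sup>2 = a b\<^sup>2 a\<close>.\<close>

lemma right_division:
  assumes a: "a \<in> L" and b: "b \<in> L"
  shows "\<exists>!y. y \<in> L \<and> mul y a = b"
proof -
  obtain a' where a': "a' \<in> SL n" "a * a' = 1\<^sub>m n" "a' * a = 1\<^sub>m n" "adj a' = a'"
    using L_inverse a by blast
  have cancel: "a * (a' * X) = X" "a' * (a * X) = X" if "X \<in> carrier_mat n n" for X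
    using assoc_mult_square[of a a' X] assoc_mult_square[of a' a X] a a'(1-3) that
    by (simp_all add: left_mult_one_mat[of _ n n])
  have char: "mul y a = b \<longleftrightarrow> a * (y * a) = act a b" if y: "y \<in> L" for y
  proof
    assume "mul y a = b"
    hence bb: "b * b = y * (a * (a * y))" using act_square[of y a] y a by (simp add: mul_eq_act L_SL)
    have "a * (y * a) \<in> L" using L_congruence[OF y L_SL[OF a]] a by simp
    moreover have "a * (y * a) * (a * (y * a)) = a * (b * b) * a" unfolding bb using a y by simp
    ultimately have "act a b = a * (y * a)" using a b by (intro act_eqI) simp_all
    thus "a * (y * a) = act a b" ..
  next
    assume e: "a * (y * a) = act a b"
    have "(a * (y * a)) * (a * (y * a)) = a * (b * (b * a))"
      unfolding e using act_square[of a b] a b L_SL by simp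
    hence "a' * ((a * (y * a)) * (a * (y * a))) * a' = a' * (a * (b * (b * a))) * a'" by simp
    hence "y * (a * (a * (y * (a * a')))) = b * (b * (a * a'))" using a y b a'(1) by (simp add: cancel)
    hence "y * (a * (a * y)) = b * b" unfolding a'(2) using a y b by (simp add: right_mult_one_mat[of _ n n])
    hence "act y a = b" using y b by (intro act_eqI) simp_all
    thus "mul y a = b" using y a by (simp add: mul_eq_act)
  qed
  \<comment> \<open>Solving \<open>a * (y * a) = act a b\<close> for \<open>y\<close> leaves this as
    the only candidate; as a congruence of \<open>act a b\<close> it lies in
    \<open>L\<close>.\<close>
  let ?y = "a' * (act a b * a')"
  have ab: "act a b \<in> L" using act_L L_SL a b by blast
  have y: "?y \<in> L" using L_congruence[OF ab a'(1)] a'(4) by simp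
  have ins: "a' * (a * (y * a) * a') = y" if "y \<in> L" for y
  proof -
    have "a' * (a * (y * a) * a') = y * (a * a')" using that a a'(1) by (simp add: cancel)
    thus ?thesis unfolding a'(2) using that by (simp add: right_mult_one_mat[of _ n n])
  qed
  show ?thesis
  proof (rule ex1I[of _ ?y])
    have "a * (?y * a) = act a b * (a' * a)" using a a'(1) ab by (simp add: cancel)
    hence "a * (?y * a) = act a b" unfolding a'(3) using ab by (simp add: right_mult_one_mat[of _ n n])
    thus "?y \<in> L \<and> mul ?y a = b" using y char by blast
  next
    fix y assume "y \<in> L \<and> mul y a = b"
    thus "y = ?y" using char ins by metis
  qed
qed

lemma is_loop_L: "is_loop L mul (1\<^sub>m n)"
  unfolding is_loop_def using mul_closed mul_one left_division right_division by simp

end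

section \<open>Normal subloops\<close>

locale normal_subloop = n_real +
  fixes N :: "'b mat set"
  assumes normal: "is_normal_subloop N L mul"
begin

text \<open>Relates elements with the same left coset of \<open>N\<close>.\<close>

definition R :: "'b mat \<Rightarrow> 'b mat \<Rightarrow> bool" where
  "R x y \<longleftrightarrow> mul x ` N = mul y ` N"

text \<open>The elements of G that induce an injective map on left cosets. The equivalence, rather
  than one implication, is what makes \<open>K\<close> closed under inverses.\<close>

definition K :: "'b mat set" where
  "K = {g \<in> SL n. \<forall>x\<in>L. \<forall>y\<in>L. R x y \<longleftrightarrow> R (act g x) (act g y)}"

text \<open>The kernel of the action on left cosets.\<close>

definition M :: "'b mat set" where
  "M = {g \<in> SL n. \<forall>b\<in>L. R (act g b) b}"

lemma N_L: "N \<subseteq> L"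
  using normal by (simp add: is_normal_subloop_def is_subloop_def)

lemma normal1: "a \<in> L \<Longrightarrow> b \<in> L \<Longrightarrow> mul (mul a b) ` N = mul a ` (mul b ` N)"
  and normal2: "a \<in> L \<Longrightarrow> b \<in> L \<Longrightarrow> mul a ` (mul b ` N) = (\<lambda>x. mul x b) ` (mul a ` N)"
  using normal by (auto simp: is_normal_subloop_def)

text \<open>The identity of the subloop is idempotent, so left cancellation in \<open>L\<close>
  identifies it with the identity matrix.\<close>

lemma one_N: "1\<^sub>m n \<in> N"
  and N_mul: "a \<in> N \<Longrightarrow> b \<in> N \<Longrightarrow> mul a b \<in> N"
  and N_div: "a \<in> N \<Longrightarrow> b \<in> N \<Longrightarrow> \<exists>x\<in>N. mul a x = b"
proof -
  obtain e where e: "is_loop N mul e"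
    using normal by (auto simp: is_normal_subloop_def is_subloop_def)
  have "e \<in> N" "mul e e = e" using e by (auto simp: is_loop_def)
  hence "mul e e = mul e (1\<^sub>m n)" "e \<in> L" using N_L mul_one by auto
  hence "e = 1\<^sub>m n" using mul_left_cancel one_in_L by blast
  thus "1\<^sub>m n \<in> N" using \<open>e \<in> N\<close> by simp
  show "a \<in> N \<Longrightarrow> b \<in> N \<Longrightarrow> mul a b \<in> N" using e by (auto simp: is_loop_def)
  show "\<exists>x\<in>N. mul a x = b" if "a \<in> N" "b \<in> N"
  proof -
    have "\<exists>!x. x \<in> N \<and> mul a x = b" using e that by (simp add: is_loop_def)
    thus ?thesis by blast
  qed
qed

lemma mul_N:
  assumes a: "a \<in> N" shows "mul a ` N = N"
proof (intro equalityI subsetI)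
  fix b assume "b \<in> N"
  then obtain x where "x \<in> N" "mul a x = b" using N_div[OF a] by blast
  thus "b \<in> mul a ` N" by blast
qed (use N_mul[OF a] in blast)

lemma mul_one_N: "mul (1\<^sub>m n) ` N = N"
  by (rule mul_N[OF one_N])

lemma R_one: "a \<in> L \<Longrightarrow> R a (1\<^sub>m n) \<Longrightarrow> a \<in> N"
  using mul_one_N mul_one(2)[of a] one_N unfolding R_def by (metis image_eqI)

lemma R_sym: "R x y \<Longrightarrow> R y x" and R_trans: "R x y \<Longrightarrow> R y z \<Longrightarrow> R x z"
  by (auto simp: R_def)

section \<open>All of G permutes the left cosets\<close>

lemma K_SL: "g \<in> K \<Longrightarrow> g \<in> SL n" and M_SL: "g \<in> M \<Longrightarrow> g \<in> SL n"
  by (auto simp: K_def M_def)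

lemma K_R: "g \<in> K \<Longrightarrow> x \<in> L \<Longrightarrow> y \<in> L \<Longrightarrow> R (act g x) (act g y) \<longleftrightarrow> R x y"
  unfolding K_def by blast

text \<open>By normality, left multiplication by \<open>a\<close> carries the coset of
  \<open>x\<close> onto the coset of \<open>mul a x\<close>; its injectivity on \<open>L\<close>
  gives the converse direction.\<close>

lemma L_in_K: assumes a: "a \<in> L" shows "a \<in> K"
proof -
  have "R x y \<longleftrightarrow> R (act a x) (act a y)" if x: "x \<in> L" and y: "y \<in> L" for x y
  proof -
    have inj: "inj_on (mul a) L" using mul_left_cancel a by (auto intro: inj_onI)
    have "mul x ` N \<subseteq> L" "mul y ` N \<subseteq> L" using mul_closed x y N_L by auto
    hence "mul a ` (mul x ` N) = mul a ` (mul y ` N) \<longleftrightarrow> mul x ` N = mul y ` N"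
      by (rule inj_on_image_eq_iff[OF inj])
    thus ?thesis using a x y by (simp only: R_def mul_eq_act[symmetric] normal1)
  qed
  thus ?thesis using L_SL[OF a] by (simp add: K_def)
qed

lemma K_mult:
  assumes g: "g \<in> K" and h: "h \<in> K"
  shows "g * h \<in> K"
proof -
  note SL = K_SL[OF g] K_SL[OF h]
  have "R x y \<longleftrightarrow> R (act (g * h) x) (act (g * h) y)" if x: "x \<in> L" and y: "y \<in> L" for x y
    unfolding act_mult[OF SL x] act_mult[OF SL y]
    using K_R[OF g act_L[OF SL(2) x] act_L[OF SL(2) y]] K_R[OF h x y] by simp
  thus ?thesis using mult_in_SL[OF SL] by (simp add: K_def)
qed

lemma K_inverse:
  assumes "g \<in> K" "h \<in> SL n" "g * h = 1\<^sub>m n"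
  shows "h \<in> K"
proof -
  have g: "g \<in> SL n" using assms by (simp add: K_SL)
  have "R x y \<longleftrightarrow> R (act h x) (act h y)" if "x \<in> L" "y \<in> L" for x y
    using K_R[OF assms(1), of "act h x" "act h y"] act_cancel[OF g assms(2,3)] act_L assms(2) that by simp
  thus ?thesis using assms(2) by (simp add: K_def)
qed

text \<open>\<open>C D C\<^sup>-\<^sup>1\<close> is the product of \<open>C D C\<^sup>*\<close> and the inverse of \<open>C C\<^sup>*\<close>, both of which are
  positive definite.\<close>

lemma K_conjugate:
  assumes C: "C \<in> SL n" and D: "D \<in> L" and g: "g \<in> SL n" and eq: "g * C = C * D"
  shows "g \<in> K"
proof -
  let ?S = "C * adj C"
  have S: "?S \<in> L" using L_congruence[OF one_in_L C] C by (simp add: left_mult_one_mat[of _ n n])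
  obtain S' where S': "S' \<in> SL n" "?S * S' = 1\<^sub>m n" using SL_inverse[OF L_SL[OF S]] by blast
  have "g * ?S = g * C * adj C" using g C by simp
  also have "\<dots> = C * (D * adj C)" unfolding eq using C D by simp
  finally have "g * ?S \<in> K" using L_in_K L_congruence[OF D C] by simp
  moreover have "S' \<in> K" using K_inverse[OF L_in_K[OF S] S'] .
  ultimately have "g * ?S * S' \<in> K" by (rule K_mult)
  moreover have "g * ?S * S' = g * (?S * S')" using g C S'(1) by simp
  ultimately show ?thesis unfolding S'(2) using g by (simp add: right_mult_one_mat[of _ n n])
qed

text \<open>For a positive diagonal \<open>D\<close> with entries 2 and 1/2 at \<open>i\<close> and
  \<open>j\<close>, the product of \<open>D\<close> and the transvection is a conjugate of
  \<open>D\<close> by another transvection. So it lies in \<open>K\<close>, and \<open>D\<close> can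
  be divided off.\<close>

lemma addrow_in_K:
  assumes ij: "i < n" "j < n" "i \<noteq> j"
  shows "addrow_mat n s i j \<in> K"
proof -
  define t :: "nat \<Rightarrow> 'a" where "t k = (if k = i then 2 else if k = j then 1/2 else 1)" for k
  have "det (diag t) = (\<Prod>k<n. emb (t k))" by (rule det_mat_diag)
  also have "\<dots> = emb (\<Prod>k<n. t k)" by (simp add: emb.hom_prod)
  also have "(\<Prod>k<n. t k) = t i * (t j * (\<Prod>k\<in>{..<n} - {i} - {j}. t k))"
    using ij by (subst prod.remove[of _ i], simp, simp, subst prod.remove[of _ j]) auto
  also have "(\<Prod>k\<in>{..<n} - {i} - {j}. t k) = 1" by (rule prod.neutral) (auto simp: t_def)
  also have "emb (t i * (t j * 1)) = 1" using ij by (simp add: t_def)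
  finally have "diag t \<in> SL n" by (simp add: SL_def del: SL_carrier)
  hence D: "diag t \<in> L" by (intro L_I pd_diag) (auto simp: t_def)
  \<comment> \<open>The solution of \<open>2 * (s + x) = x / 2\<close>, which is what comparing the
    entries at \<open>(i,j)\<close> demands.\<close>
  define x where "x = s * emb (- 4 / 3)"
  have E: "addrow_mat n s i j \<in> SL n" "addrow_mat n x i j \<in> SL n" using ij by (auto intro: addrow_mat_in_SL)
  have key: "emb 2 * (s + x) = x * emb (1 / 2)"
  proof -
    have "emb 2 * (s + x) = s * (emb 2 * (emb 1 + emb (- 4 / 3)))" by (simp add: x_def algebra_simps)
    also have "emb 2 * (emb 1 + emb (- 4 / 3)) = emb (2 * (1 + - 4 / 3))" by (simp only: emb.hom_add emb.hom_mult)
    also have "2 * (1 + - 4 / 3) = - 4 / 3 * (1 / 2 :: 'a)" by simp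
    finally show ?thesis by (simp only: x_def emb.hom_mult ac_simps)
  qed
  have "addrow_mat n s i j * addrow_mat n x i j = addrow s i j (addrow_mat n x i j)"
    by (rule addrow_mat[symmetric]) (use ij in auto)
  also have "\<dots> = addrow_mat n (s + x) i j" by (rule eq_matI) (use ij in auto)
  finally have EE: "addrow_mat n s i j * addrow_mat n x i j = addrow_mat n (s + x) i j" .
  have "diag t * addrow_mat n s i j * addrow_mat n x i j = diag t * addrow_mat n (s + x) i j"
    using E by (simp add: EE)
  also have "\<dots> = addrow_mat n x i j * diag t"
    by (rule eq_matI) (use ij key in \<open>auto simp: mat_diag_mult_left[of _ n n] mat_diag_mult_right[of _ n n] t_def\<close>)
  finally have "diag t * addrow_mat n s i j \<in> K"
    using K_conjugate[OF E(2) D mult_in_SL[OF L_SL[OF D] E(1)]] by blast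
  moreover obtain D' where D': "D' \<in> SL n" "diag t * D' = 1\<^sub>m n" "D' * diag t = 1\<^sub>m n"
    using SL_inverse[OF L_SL[OF D]] by blast
  ultimately have "D' * (diag t * addrow_mat n s i j) \<in> K"
    using K_mult K_inverse[OF L_in_K[OF D] D'(1,2)] by blast
  moreover have "D' * (diag t * addrow_mat n s i j) = D' * diag t * addrow_mat n s i j" using D'(1) E(1) by simp
  ultimately show ?thesis unfolding D'(3) by simp
qed

lemma SL_in_K: "g \<in> SL n \<Longrightarrow> g \<in> K"
  by (rule SL_generated[where S = K]) (auto intro: L_in_K K_mult addrow_in_K)

section \<open>The kernel of the action on cosets is a normal subgroup\<close>

lemma M_R: "g \<in> M \<Longrightarrow> b \<in> L \<Longrightarrow> R (act g b) b"
  by (simp add: M_def)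

lemma M_mult:
  assumes g: "g \<in> M" and h: "h \<in> M"
  shows "g * h \<in> M"
proof -
  note SL = M_SL[OF g] M_SL[OF h]
  have "R (act (g * h) b) b" if b: "b \<in> L" for b
    unfolding act_mult[OF SL b]
    using R_trans[OF M_R[OF g act_L[OF SL(2) b]] M_R[OF h b]] .
  thus ?thesis using mult_in_SL[OF SL] by (simp add: M_def)
qed

lemma M_inverse:
  assumes "g \<in> M" "h \<in> SL n" "g * h = 1\<^sub>m n"
  shows "h \<in> M"
proof -
  have "R (act h b) b" if b: "b \<in> L" for b
  proof -
    have "R (act g (act h b)) (act h b)" using assms act_L b by (simp add: M_def)
    thus ?thesis using act_cancel[OF _ assms(2,3) b] assms(1) R_sym by (simp add: M_def)
  qed
  thus ?thesis using assms(2) by (simp add: M_def)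
qed

text \<open>Every \<open>g\<close> in G respects \<open>R\<close> by \<open>SL_in_K\<close>, so it
  transports the relation at \<open>act g' b\<close> to one at \<open>b\<close>.\<close>

lemma M_conjugate:
  assumes m: "m \<in> M" and g: "g \<in> SL n" "g' \<in> SL n" "g * g' = 1\<^sub>m n"
  shows "g * (m * g') \<in> M"
proof -
  have "R (act (g * (m * g')) b) b" if b: "b \<in> L" for b
  proof -
    have c: "act g' b \<in> L" using act_L g b by blast
    hence "R (act m (act g' b)) (act g' b)" using m by (simp add: M_def)
    hence "R (act g (act m (act g' b))) (act g (act g' b))"
      using K_R[OF SL_in_K[OF g(1)]] act_L M_SL[OF m] c by blast
    thus ?thesis using g m b c act_L by (simp add: act_mult mult_in_SL M_SL act_cancel)
  qed
  thus ?thesis using g m by (simp add: M_def mult_in_SL)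
qed

text \<open>The equation is an inverse-free way to say that \<open>h\<close> is the commutator of
  \<open>m\<close> and \<open>g\<close>; this is \<open>m\<close> times a conjugate of its
  inverse.\<close>

lemma M_commutator:
  assumes m: "m \<in> M" and g: "g \<in> SL n" and h: "h \<in> SL n" and eq: "m * g = h * (g * m)"
  shows "h \<in> M"
proof -
  obtain g' where g': "g' \<in> SL n" "g * g' = 1\<^sub>m n" "g' * g = 1\<^sub>m n" using SL_inverse[OF g] by blast
  obtain m' where m': "m' \<in> SL n" "m * m' = 1\<^sub>m n" "m' * m = 1\<^sub>m n" using SL_inverse[OF M_SL[OF m]] by blast
  have "m' \<in> M" using M_inverse[OF m m'(1,2)] .
  hence "m * (g * (m' * g')) \<in> M" by (intro M_mult m M_conjugate g g')
  moreover have "m * (g * (m' * g')) = (m * g) * (m' * g')" using M_SL[OF m] g g'(1) m'(1) by simp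
  also have "\<dots> = h * (g * ((m * m') * g'))" unfolding eq using M_SL[OF m] g h g'(1) m'(1) by simp
  also have "\<dots> = h" unfolding m'(2) using g'(1,2) h
    by (simp add: left_mult_one_mat[of _ n n] right_mult_one_mat[of _ n n])
  finally show ?thesis by simp
qed

text \<open>For \<open>a\<close> in \<open>N\<close>, normality rewrites \<open>(a b) N\<close> as
  \<open>(a N) b\<close>, which is \<open>N b\<close> because \<open>a N = N\<close>, and then as
  \<open>b N\<close>.\<close>

lemma N_in_M:
  assumes a: "a \<in> N" shows "a \<in> M"
proof -
  have aL: "a \<in> L" using a N_L by blast
  have "R (act a b) b" if b: "b \<in> L" for b
  proof -
    have "mul (mul a b) ` N = (\<lambda>x. mul x b) ` (mul a ` N)" using normal1 normal2 aL b by simp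
    also have "mul a ` N = mul (1\<^sub>m n) ` N" using mul_N a mul_one_N by simp
    also have "(\<lambda>x. mul x b) ` (mul (1\<^sub>m n) ` N) = mul (mul (1\<^sub>m n) b) ` N"
      using normal1[OF one_in_L b] normal2[OF one_in_L b] by simp
    also have "mul (1\<^sub>m n) b = b" by (rule mul_one(1)[OF b])
    finally show ?thesis using aL b by (simp add: R_def mul_eq_act)
  qed
  thus ?thesis using L_SL[OF aL] by (simp add: M_def)
qed

section \<open>From a nontrivial element of N to all transvections\<close>

lemma diagonalizable_in_SL:
  assumes A: "A \<in> L"
  obtains P d where "P \<in> SL n" "A * P = P * diag d" "\<And>i. i < n \<Longrightarrow> d i > 0"
proof -
  obtain P d where P: "P \<in> carrier_mat n n" "adj P * P = 1\<^sub>m n" "A * P = P * diag d"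
    and d: "\<And>i. i < n \<Longrightarrow> d i > 0"
    using pd_unitary[OF L_pd[OF A]] by metis
  have "det P \<noteq> 0" using P(1,2) det_mult[of "adj P" n P] by auto
  \<comment> \<open>Rescaling the first column of \<open>P\<close> makes the determinant one. This
    may destroy unitarity, but \<open>F\<close> commutes with the diagonal matrix, so
    \<open>P * F\<close> still diagonalizes \<open>A\<close>.\<close>
  define F where "F = mat_diag n (\<lambda>i. if i = 0 then inverse (det P) else 1)"
  have F: "F \<in> carrier_mat n n" by (simp add: F_def)
  have "det F = (\<Prod>i<n. if i = 0 then inverse (det P) else 1)"
    unfolding F_def by (rule det_mat_diag)
  also have "\<dots> = inverse (det P)" using n2 by (simp add: prod.delta)
  finally have "P * F \<in> SL n" using P(1) F \<open>det P \<noteq> 0\<close> by (simp add: SL_def det_mult[of _ n] del: SL_carrier)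
  moreover have "A * (P * F) = P * F * diag d"
  proof -
    have "A * (P * F) = P * (diag d * F)" using A P(1) F P(3) assoc_mult_square[of A P F] by simp
    also have "diag d * F = F * diag d" by (simp add: F_def mult.commute)
    finally show ?thesis using P(1) F by simp
  qed
  ultimately show thesis using that d by blast
qed

lemma diagonal_in_M:
  assumes a: "a \<in> N" "a \<noteq> 1\<^sub>m n"
  obtains d i j where "diag d \<in> M" "i < n" "j < n" "d i \<noteq> d j"
proof -
  have aL: "a \<in> L" using a N_L by blast
  obtain P d where P: "P \<in> SL n" "a * P = P * diag d" and d: "\<And>i. i < n \<Longrightarrow> d i > 0"
    using diagonalizable_in_SL[OF aL] by blast
  obtain P' where P': "P' \<in> SL n" "P * P' = 1\<^sub>m n" "P' * P = 1\<^sub>m n" using SL_inverse[OF P(1)] by blast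
  have "P' * (a * P) = (P' * P) * diag d" unfolding P(2) using P(1) P'(1) by simp
  hence D: "diag d = P' * (a * P)" unfolding P'(3) by simp
  have DM: "diag d \<in> M" unfolding D by (rule M_conjugate[OF N_in_M[OF a(1)] P'(1) P(1) P'(3)])
  \<comment> \<open>If all eigenvalues were equal, determinant one and positivity would force them
    to be one, and \<open>a\<close> would be the identity matrix.\<close>
  have "\<exists>i<n. d i \<noteq> d 0"
  proof (rule ccontr)
    assume "\<not> ?thesis"
    hence c: "d i = d 0" if "i < n" for i using that by blast
    have "det (diag d) = (\<Prod>i<n. emb (d i))" by (rule det_mat_diag)
    also have "\<dots> = (\<Prod>i<n. emb (d 0))" by (intro prod.cong refl arg_cong[of _ _ emb] c) simp
    also have "\<dots> = emb (d 0 ^ n)" by (simp add: emb.hom_power)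
    finally have "emb (d 0 ^ n) = emb 1" using M_SL[OF DM] by (simp add: SL_def del: SL_carrier)
    hence "d 0 ^ n = 1 ^ n" by (simp only: emb.eq_iff power_one)
    hence "d 0 = 1" using power_eq_imp_eq_base[of "d 0" n 1] d[of 0] n2 by simp
    hence "d i = 1" if "i < n" for i using c[OF that] by (rule trans[rotated])
    hence "diag d = 1\<^sub>m n" by (intro eq_matI) (auto simp: mat_diag_def)
    hence "a * P * P' = P * P'" using P by (simp add: right_mult_one_mat[of _ n n])
    moreover have "a * P * P' = a * (P * P')" using P(1) P'(1) aL by simp
    ultimately show False using a(2) aL unfolding P'(2) by (simp add: right_mult_one_mat[of _ n n])
  qed
  thus thesis using that DM n2 by (metis less_le_trans pos2)
qed

text \<open>If \<open>d i\<close> and \<open>d j\<close> differ, the transvection is a commutator of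
  \<open>diag d\<close> with another transvection. Otherwise some \<open>d m\<close> differs from
  both, and the transvection at \<open>(i,j)\<close> is the commutator of those at
  \<open>(i,m)\<close> and \<open>(m,j)\<close>, the first of which is already in
  \<open>M\<close>.\<close>

lemma addrow_in_M:
  assumes D: "diag d \<in> M" and kl: "k < n" "l < n" "d k \<noteq> d l" and ij: "i < n" "j < n" "i \<noteq> j"
  shows "addrow_mat n s i j \<in> M"
proof -
  have direct: "addrow_mat n s i j \<in> M" if ij: "i < n" "j < n" "i \<noteq> j" and neq: "d i \<noteq> d j" for i j s
  proof (rule M_commutator[OF D])
    \<comment> \<open>Solves \<open>d i * x = (s + x) * d j\<close>, the condition at position
      \<open>(i,j)\<close>.\<close>
    define x where "x = s * emb (d j) / (emb (d i) - emb (d j))"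
    have "emb (d i) - emb (d j) \<noteq> 0" using neq by (simp add: emb.eq_iff)
    hence key: "emb (d i) * x = (s + x) * emb (d j)" by (simp add: x_def field_simps)
    show "addrow_mat n x i j \<in> SL n" "addrow_mat n s i j \<in> SL n" using ij by (auto intro: addrow_mat_in_SL)
    have "addrow_mat n s i j * (addrow_mat n x i j * diag d)
        = addrow s i j (addrow_mat n x i j * diag d)"
      by (rule addrow_mat[symmetric]) (use ij in auto)
    also have "\<dots> = diag d * addrow_mat n x i j"
      by (rule eq_matI) (use ij key in \<open>auto simp: mat_diag_mult_left[of _ n n] mat_diag_mult_right[of _ n n] algebra_simps\<close>)
    finally show "diag d * addrow_mat n x i j = addrow_mat n s i j * (addrow_mat n x i j * diag d)" ..
  qed
  show ?thesis
  proof (cases "d i = d j")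
    case False
    thus ?thesis using direct ij by blast
  next
    case True
    obtain m where m: "m < n" "d i \<noteq> d m" using kl by metis
    hence ne: "i \<noteq> m" "j \<noteq> m" using True by auto
    show ?thesis
    proof (rule M_commutator)
      show "addrow_mat n 1 i m \<in> M" using direct ij(1) m ne(1) by blast
      show "addrow_mat n s m j \<in> SL n" "addrow_mat n s i j \<in> SL n" using ij ne by (auto intro: addrow_mat_in_SL)
      have "addrow_mat n s m j * addrow_mat n 1 i m = addrow s m j (addrow_mat n 1 i m)"
        by (rule addrow_mat[symmetric]) (use ij in auto)
      hence "addrow_mat n s i j * (addrow_mat n s m j * addrow_mat n 1 i m)
          = addrow s i j (addrow s m j (addrow_mat n 1 i m))"
        by (simp only:) (rule addrow_mat[symmetric], use ij in auto)
      also have "\<dots> = addrow 1 i m (addrow_mat n s m j)"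
        by (rule eq_matI) (use ij m ne in auto)
      also have "\<dots> = addrow_mat n 1 i m * addrow_mat n s m j"
        by (rule addrow_mat) (use m in auto)
      finally show "addrow_mat n 1 i m * addrow_mat n s m j
          = addrow_mat n s i j * (addrow_mat n s m j * addrow_mat n 1 i m)" ..
    qed
  qed
qed

lemma normal_subloop_trivial: "N = {1\<^sub>m n} \<or> N = L"
proof (rule disjCI)
  assume "N \<noteq> L"
  show "N = {1\<^sub>m n}"
  proof (rule ccontr)
    assume "N \<noteq> {1\<^sub>m n}"
    then obtain a where "a \<in> N" "a \<noteq> 1\<^sub>m n" using one_N by blast
    then obtain d k l where d: "diag d \<in> M" "k < n" "l < n" "d k \<noteq> d l" using diagonal_in_M by metis
    \<comment> \<open>Once \<open>M\<close> is all of G, each \<open>b\<close> in \<open>L\<close>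
      moves the identity within its coset, which is \<open>N\<close>.\<close>
    have M: "g \<in> M" if "g \<in> SL n" for g
      by (rule SL_generated[where S = M, OF _ M_mult addrow_in_M[OF d] that])
        (auto intro: N_in_M one_N)
    have "b \<in> N" if b: "b \<in> L" for b
    proof (rule R_one[OF b])
      have "R (act b (1\<^sub>m n)) (1\<^sub>m n)" using M[OF L_SL[OF b]] by (simp add: M_def)
      thus "R b (1\<^sub>m n)" using b by (simp add: act_on_one)
    qed
    thus False using N_L \<open>N \<noteq> L\<close> by blast
  qed
qed

end

lemma (in n_real) is_simple_loop_L: "is_simple_loop L mul (1\<^sub>m n)"
  unfolding is_simple_loop_def
proof (intro conjI is_loop_L allI impI)
  fix N assume "is_normal_subloop N L mul"
  then interpret normal_subloop emb cj n N by unfold_locales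
  show "N = {1\<^sub>m n} \<or> N = L" by (rule normal_subloop_trivial)
qed

section \<open>The two cases of the theorem\<close>

context conj_field
begin

text \<open>Moving \<open>A\<close> across the form at an eigenvector \<open>v\<close> replaces the
  eigenvalue by its conjugate, and the form of \<open>v\<close> with itself is nonzero.\<close>

lemma hermitian_eigenvalue_real:
  assumes A: "A \<in> carrier_mat n n" "adj A = A" and "eigenvalue A \<mu>"
  shows "\<exists>r. \<mu> = emb r"
proof (rule cj_fixed)
  obtain v where v: "v \<in> carrier_vec n" "v \<noteq> 0\<^sub>v n" "A *\<^sub>v v = \<mu> \<cdot>\<^sub>v v"
    using assms by (auto simp: eigenvalue_def eigenvector_def)
  have vv: "map_vec cj v \<bullet> v \<noteq> 0"
    unfolding cscalar_self[OF v(1)] using sum_nrm_pos[OF v(1,2), of "\<lambda>_. 1"] by (simp del: emb.hom_sum)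
  have "map_vec cj v \<bullet> (\<mu> \<cdot>\<^sub>v v) = map_vec cj (\<mu> \<cdot>\<^sub>v v) \<bullet> v"
    using cscalar_adj[OF A(1) v(1) v(1)] unfolding A(2) v(3) .
  also have "map_vec cj (\<mu> \<cdot>\<^sub>v v) = cj \<mu> \<cdot>\<^sub>v map_vec cj v" by (rule cj.vec_hom_smult)
  finally have "\<mu> * (map_vec cj v \<bullet> v) = cj \<mu> * (map_vec cj v \<bullet> v)" using v(1) by simp
  thus "cj \<mu> = \<mu>" using vv by simp
qed

text \<open>In the symmetric case the hypothesis concerns splitting over \<open>R(i)\<close>, while
  the locale asks for splitting over \<open>R\<close>. The roots are eigenvalues of a self-adjoint
  matrix and thus come from \<open>R\<close>, so the factorization descends along the injective
  \<open>map_poly emb\<close>.\<close>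

lemma symmetric_splits:
  assumes A: "A \<in> carrier_mat n n" "transpose_mat A = A"
    and splits: "splits_linear (char_poly (map_mat emb A))"
  shows "splits_linear (char_poly A)"
proof -
  interpret map_poly_hom: map_poly_inj_idom_hom emb ..
  let ?A = "map_mat emb A"
  have A': "?A \<in> carrier_mat n n" using A by simp
  have "adj ?A = map_mat emb (transpose_mat A)" by (rule eq_matI) auto
  hence adj: "adj ?A = ?A" using A by simp
  obtain as where as: "char_poly ?A = (\<Prod>a\<leftarrow>as. [:- a, 1:])" using char_poly_splits[OF A' splits] by blast
  have "\<exists>r. a = emb r" if "a \<in> set as" for a
  proof (rule hermitian_eigenvalue_real[OF A' adj])
    have "poly (\<Prod>a\<leftarrow>as. [:- a, 1:]) a = 0" using that by (induction as) auto
    thus "eigenvalue ?A a" using eigenvalue_root_char_poly[OF A'] as by simp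
  qed
  then obtain f where f: "\<And>a. a \<in> set as \<Longrightarrow> a = emb (f a)" by metis
  have "(\<Prod>a\<leftarrow>as. [:- a, 1:]) = map_poly emb (\<Prod>a\<leftarrow>map f as. [:- a, 1:])"
    using f by (induction as) (auto simp: map_poly_hom.hom_mult emb.hom_uminus simp del: mult_pCons_left)
  hence "map_poly emb (char_poly A) = map_poly emb (\<Prod>a\<leftarrow>map f as. [:- a, 1:])"
    using as emb.char_poly_hom[OF A(1)] by simp
  hence "char_poly A = (\<Prod>a\<leftarrow>map f as. [:- a, 1:])"
    by (simp only: map_poly_hom.eq_iff)
  thus ?thesis unfolding splits_linear_def by (metis smult_1_left)
qed

end

section \<open>The instances for \<open>R\<close> and \<open>R(i)\<close>\<close>

lemma conj_field_base: "conj_field (\<lambda>x :: 'a::linordered_field. x) (\<lambda>x. x)"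
proof unfold_locales
  show "\<exists>r>0. x * x = r" if "x \<noteq> 0" for x :: 'a
    using that by (simp add: zero_less_mult_iff linorder_neq_iff disj_commute)
qed auto

lemma conj_field_adj_i: "conj_field (of_base :: 'a::linordered_field \<Rightarrow> _) conjugate"
proof unfold_locales
  show "\<exists>r. x = of_base r" if "conjugate x = x" for x :: "'a adj_i"
    using that by (intro exI[of _ "re_part x"]) (simp add: conjugate_adj_i_def of_base_def adj_i_eq_iff)
  show "\<exists>r>0. x * conjugate x = of_base r" if "x \<noteq> 0" for x :: "'a adj_i"
    using that by (intro exI[of _ "(re_part x)\<^sup>2 + (im_part x)\<^sup>2"])
      (auto simp: adj_i_eq_iff adj_i_defs conjugate_adj_i_def of_base_def power2_eq_square sum_squares_gt_zero_iff)
qed (auto simp: adj_i_eq_iff adj_i_defs conjugate_adj_i_def of_base_def)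

lemma adj_base: "conj_field.adj (\<lambda>x. x) A = transpose_mat (A :: 'a::linordered_field mat)"
  unfolding conj_field.adj_def[OF conj_field_base] by (rule eq_matI) auto

lemma pd_base: "conj_field.pd (\<lambda>x. x) (\<lambda>x. x) n = (pd_symmetric n :: 'a::linordered_field mat set)"
proof -
  have "map_vec (\<lambda>x. x) v = v" for v :: "'a vec" by (rule eq_vecI) auto
  thus ?thesis
    unfolding conj_field.pd_def[OF conj_field_base] pd_symmetric_def adj_base by simp
qed

lemma adj_conjugate:
  assumes "A \<in> carrier_mat n n"
  shows "conj_field.adj conjugate A = mat_adjoint (A :: 'a::linordered_field adj_i mat)"
  unfolding conj_field.adj_def[OF conj_field_adj_i]
  by (rule eq_matI) (use assms in \<open>auto simp: mat_adjoint_def mat_of_rows_index\<close>)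

lemma pd_adj_i: "conj_field.pd of_base conjugate n = (pd_hermitian n :: 'a::linordered_field adj_i mat set)"
proof -
  have "map_vec conjugate v = conjugate v" for v :: "'a adj_i vec" by (rule eq_vecI) auto
  \<comment> \<open>In the partial order on \<open>R(i)\<close>, being positive includes having
    imaginary part zero.\<close>
  moreover have "(\<exists>r>0. x = of_base r) \<longleftrightarrow> x > 0" for x :: "'a adj_i"
    by (cases x) (auto simp: of_base_def less_adj_i_def zero_adj_i_def)
  ultimately show ?thesis
    unfolding conj_field.pd_def[OF conj_field_adj_i] pd_hermitian_def
    by (intro Collect_cong conj_cong refl) (simp_all add: adj_conjugate)
qed

theorem theorem2p3:
  fixes n :: nat
  assumes "n \<ge> 2"
  shows
    "(n_real_symmetric TYPE('a::linordered_field) n \<longrightarrow>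
        (let L\<^sub>G = (pd_symmetric n :: 'a mat set) \<inter> SL n
         in is_simple_loop L\<^sub>G (transversal_mult L\<^sub>G (SO n)) (1\<^sub>m n))) \<and>
     (n_real_hermitian TYPE('a) n \<longrightarrow>
        (let L\<^sub>G = (pd_hermitian n :: 'a adj_i mat set) \<inter> SL n
         in is_simple_loop L\<^sub>G (transversal_mult L\<^sub>G (SU n)) (1\<^sub>m n)))"
proof (intro conjI impI)
  assume real: "n_real_symmetric TYPE('a) n"
  have n_real: "n_real (\<lambda>x :: 'a. x) (\<lambda>x. x) n"
  proof (intro n_real.intro conj_field_base n_real_axioms.intro assms)
    fix A :: "'a mat" assume "A \<in> conj_field.pd (\<lambda>x. x) (\<lambda>x. x) n"
    hence A: "A \<in> pd_symmetric n" by (simp only: pd_base)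
    hence "splits_linear (char_poly (map_mat of_base A))" using real by (simp add: n_real_symmetric_def)
    moreover have "A \<in> carrier_mat n n" "transpose_mat A = A" using A by (auto simp: pd_symmetric_def)
    ultimately show "splits_linear (char_poly A)"
      using conj_field.symmetric_splits[OF conj_field_adj_i] by blast
  qed
  show "let L\<^sub>G = (pd_symmetric n :: 'a mat set) \<inter> SL n
    in is_simple_loop L\<^sub>G (transversal_mult L\<^sub>G (SO n)) (1\<^sub>m n)"
    using n_real.is_simple_loop_L[OF n_real]
    unfolding n_real.L_def[OF n_real] n_real.U_def[OF n_real] pd_base adj_base SO_def Let_def .
next
  assume real: "n_real_hermitian TYPE('a) n"
  have n_real: "n_real (of_base :: 'a \<Rightarrow> _) conjugate n"
    using real assms
    by (intro n_real.intro conj_field_adj_i n_real_axioms.intro) (auto simp: pd_adj_i n_real_hermitian_def)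
  have "n_real.U conjugate n = (SU n :: 'a adj_i mat set)"
    unfolding n_real.U_def[OF n_real] SU_def
    by (intro Collect_cong conj_cong refl) (simp add: adj_conjugate[of _ n] SL_carrier)
  thus "let L\<^sub>G = (pd_hermitian n :: 'a adj_i mat set) \<inter> SL n
    in is_simple_loop L\<^sub>G (transversal_mult L\<^sub>G (SU n)) (1\<^sub>m n)"
    using n_real.is_simple_loop_L[OF n_real] unfolding n_real.L_def[OF n_real] pd_adj_i Let_def by simp
qed

end
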